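(* Let $\nu(u)$ and $\mu(u)$ be smooth functions on an interval $J\subset\mathbb R$ satisfying $$\mu>0,\quad \nu\neq0,\quad \mu^2\ne\nu^2,\quad |\mu^2-\nu^2|_u\neq0,\quad \Big|\frac{\mu+\nu}{\mu-\nu}\Big|_u\neq0,$$ $$\tfrac14\big(\ln|\mu^2-\nu^2|\big)_{uu}-\tfrac1{16}\big(\ln|\mu^2-\nu^2|\big)_u^2+\nu^2+\mu^2=0,$$ $$\tfrac12\Big(\ln\Big|\frac{\mu+\nu}{\mu-\nu}\Big|\Big)_{uu}-\tfrac18\big(\ln|\mu^2-\nu^2|\big)_u\Big(\ln\Big|\frac{\mu+\nu}{\mu-\nu}\Big|\Big)_u+2\nu\mu=0 .$$ Then there exists a unique up to a rigid motion of $\mathbb R^4$ minimal surface of general type $M^2: z=z(u,v)$, $(u,v)\in\mathcal D_0=J\times J'$ for some interval $J'\subset\mathbb R$, satisfying $\gamma_1=0$, with invariants $\nu(u)$ and $\mu(u)$; furthermore $(u,v)$ are canonical parameters of $M^2$ (i.e. semi-canonical with $E=1$, $F=0$, $G=|\mu^2-\nu^2|^{-1/2}$).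
   Context: $\mathbb R^4$ carries the standard metric $g=\langle\cdot,\cdot\rangle$ and flat connection $\nabla'$; everything is smooth and local. For a regular surface $M^2: z=z(u,v)$ let $E,F,G$ be the first fundamental form coefficients, $\sigma$ the second fundamental form, $K$ the Gauss curvature, and $\varkappa$ the curvature of the normal connection, $\varkappa=g(R^\perp(x,y)n_2,n_1)$ for a positively oriented orthonormal frame $(x,y,n_1,n_2)$ with $x,y$ tangent. Minimal means $\sigma(x,x)+\sigma(y,y)=0$ for orthonormal tangent $x,y$. A minimal surface is of general type if $K^2-\varkappa^2>0$ and $\varkappa\neq0$ everywhere. The ellipse of curvature at $p$ is $\{\sigma(v,v): v\in T_pM^2,\ |v|=1\}$; a tangent line is canonical if it is collinear with an axis of this ellipse. The geometric frame is a positively oriented orthonormal frame $\{x,y,n_1,n_2\}$ with $x,y$ canonical tangent fields and $n_1,n_2$ normal, satisfying $\nabla'_xx=\gamma_1y+\nu n_1$, $\nabla'_xy=-\gamma_1x+\mu n_2$, $\nabla'_yx=-\gamma_2y+\mu n_2$, $\nabla'_yy=\gamma_2x-\nu n_1$, $\nabla'_xn_1=-\nu x+\beta_1n_2$, $\nabla'_yn_1=\nu y+\beta_2n_2$, $\nabla'_xn_2=-\mu y-\beta_1n_1$, $\nabla'_yn_2=-\mu x-\beta_2n_1$, with $\mu>0$, $\nu\ne0$, $\mu^2\ne\nu^2$; the functions $\nu,\mu,\gamma_1,\gamma_2,\beta_1,\beta_2$ are the invariants of $M^2$. Parameters $(u,v)$ are semi-canonical if the parametric lines are integral curves of the canonical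 tangents, with $F=0$, $x=z_u/\sqrt E$, $y=z_v/\sqrt G$; then $\gamma_1=-y(\ln\sqrt E)$, $\gamma_2=-x(\ln\sqrt G)$. *)

theory Defs
  imports "HOL-Analysis.Analysis"
begin

type_synonym surf = "real \<times> real \<Rightarrow> real^4"

definition pu :: "(real \<times> real \<Rightarrow> 'a::real_normed_vector) \<Rightarrow> real \<times> real \<Rightarrow> 'a" where
  "pu f = (\<lambda>(u,v). vector_derivative (\<lambda>t. f (t,v)) (at u))"

definition pv :: "(real \<times> real \<Rightarrow> 'a::real_normed_vector) \<Rightarrow> real \<times> real \<Rightarrow> 'a" where
  "pv f = (\<lambda>(u,v). vector_derivative (\<lambda>t. f (u,t)) (at v))"

fun iter_pd :: "bool list \<Rightarrow> (real \<times> real \<Rightarrow> 'a::real_normed_vector) \<Rightarrow> real \<times> real \<Rightarrow> 'a" where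
  "iter_pd [] f = f"
| "iter_pd (b # bs) f = (if b then pu else pv) (iter_pd bs f)"

definition smooth2_on :: "(real \<times> real) set \<Rightarrow> (real \<times> real \<Rightarrow> 'a::real_normed_vector) \<Rightarrow> bool" where
  "smooth2_on D f \<longleftrightarrow> open D \<and> (\<forall>bs. \<forall>p\<in>D. iter_pd bs f differentiable (at p))"

definition smooth1_on :: "real set \<Rightarrow> (real \<Rightarrow> real) \<Rightarrow> bool" where
  "smooth1_on J f \<longleftrightarrow> open J \<and> (\<forall>k. \<forall>u\<in>J. ((deriv ^^ k) f) differentiable (at u))"

definition fE :: "surf \<Rightarrow> real \<times> real \<Rightarrow> real" where "fE z p = pu z p \<bullet> pu z p"
definition fF :: "surf \<Rightarrow> real \<times> real \<Rightarrow> real" where "fF z p = pu z p \<bullet> pv z p"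
definition fG :: "surf \<Rightarrow> real \<times> real \<Rightarrow> real" where "fG z p = pv z p \<bullet> pv z p"
definition gram :: "surf \<Rightarrow> real \<times> real \<Rightarrow> real" where "gram z p = fE z p * fG z p - (fF z p)\<^sup>2"

definition regular_surface :: "surf \<Rightarrow> (real \<times> real) set \<Rightarrow> bool" where
  "regular_surface z D \<longleftrightarrow> smooth2_on D z \<and> (\<forall>p\<in>D. gram z p > 0)"

definition tangent_space :: "surf \<Rightarrow> real \<times> real \<Rightarrow> (real^4) set" where
  "tangent_space z p = span {pu z p, pv z p}"

definition tcoord :: "surf \<Rightarrow> real \<times> real \<Rightarrow> real^4 \<Rightarrow> real \<times> real" where
  "tcoord z p w =
     ((fG z p * (w \<bullet> pu z p) - fF z p * (w \<bullet> pv z p)) / gram z p,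
      (fE z p * (w \<bullet> pv z p) - fF z p * (w \<bullet> pu z p)) / gram z p)"

definition tproj :: "surf \<Rightarrow> real \<times> real \<Rightarrow> real^4 \<Rightarrow> real^4" where
  "tproj z p w = fst (tcoord z p w) *\<^sub>R pu z p + snd (tcoord z p w) *\<^sub>R pv z p"

definition nproj :: "surf \<Rightarrow> real \<times> real \<Rightarrow> real^4 \<Rightarrow> real^4" where
  "nproj z p w = w - tproj z p w"

definition sff :: "surf \<Rightarrow> real \<times> real \<Rightarrow> real^4 \<Rightarrow> real^4 \<Rightarrow> real^4" where
  "sff z p X Y =
     (let (a,b) = tcoord z p X; (c,d) = tcoord z p Y in
      nproj z p ((a*c) *\<^sub>R pu (pu z) p + (a*d) *\<^sub>R pv (pu z) p
                 + (b*c) *\<^sub>R pu (pv z) p + (b*d) *\<^sub>R pv (pv z) p))"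

definition is_minimal :: "surf \<Rightarrow> (real \<times> real) set \<Rightarrow> bool" where
  "is_minimal z D \<longleftrightarrow> (\<forall>p\<in>D. \<forall>X Y. X \<in> tangent_space z p \<longrightarrow> Y \<in> tangent_space z p \<longrightarrow>
      X \<bullet> X = 1 \<longrightarrow> Y \<bullet> Y = 1 \<longrightarrow> X \<bullet> Y = 0 \<longrightarrow> sff z p X X + sff z p Y Y = 0)"

text \<open>centre of the ellipse of curvature (mean curvature vector)\<close>
definition ellipse_center :: "surf \<Rightarrow> real \<times> real \<Rightarrow> real^4" where
  "ellipse_center z p =
     (1 / (2 * gram z p)) *\<^sub>R (fG z p *\<^sub>R sff z p (pu z p) (pu z p)
        - (2 * fF z p) *\<^sub>R sff z p (pu z p) (pv z p) + fE z p *\<^sub>R sff z p (pv z p) (pv z p))"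

text \<open>The tangent line spanned by the unit tangent vector w is canonical iff sigma(w,w) is a
  vertex of the ellipse of curvature, i.e. lies on an axis (extremal distance from the centre).\<close>
definition canonical_dir :: "surf \<Rightarrow> real \<times> real \<Rightarrow> real^4 \<Rightarrow> bool" where
  "canonical_dir z p w \<longleftrightarrow> w \<in> tangent_space z p \<and> w \<bullet> w = 1 \<and>
     ((\<forall>v \<in> tangent_space z p. v \<bullet> v = 1 \<longrightarrow>
          norm (sff z p v v - ellipse_center z p) \<le> norm (sff z p w w - ellipse_center z p)) \<or>
      (\<forall>v \<in> tangent_space z p. v \<bullet> v = 1 \<longrightarrow>
          norm (sff z p w w - ellipse_center z p) \<le> norm (sff z p v v - ellipse_center z p)))"

text \<open>Gauss curvature K = g(R(z_u,z_v)z_v, z_u)/(EG-F^2), with R the curvature of the induced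
  (Levi-Civita) connection nabla = tangent part of the flat connection.\<close>
definition gauss_curv :: "surf \<Rightarrow> real \<times> real \<Rightarrow> real" where
  "gauss_curv z p =
     ((tproj z p (pu (\<lambda>q. tproj z q (pv (pv z) q)) p)
       - tproj z p (pv (\<lambda>q. tproj z q (pu (pv z) q)) p)) \<bullet> pu z p) / gram z p"

text \<open>Curvature of the normal connection kappa = g(R^perp(x,y) n2, n1) for a positively oriented
  orthonormal frame (x,y,n1,n2); here computed with R^perp(z_u,z_v) and normalised.\<close>
definition det4 :: "real^4 \<Rightarrow> real^4 \<Rightarrow> real^4 \<Rightarrow> real^4 \<Rightarrow> real" where
  "det4 a b c d = det (vector [a, b, c, d] :: real^4^4)"

definition normal_curv :: "surf \<Rightarrow> surf \<Rightarrow> surf \<Rightarrow> real \<times> real \<Rightarrow> real" where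
  "normal_curv z n1 n2 p =
     sgn (det4 (pu z p) (pv z p) (n1 p) (n2 p)) *
     ((nproj z p (pu (\<lambda>q. nproj z q (pv n2 q)) p)
       - nproj z p (pv (\<lambda>q. nproj z q (pu n2 q)) p)) \<bullet> n1 p) / sqrt (gram z p)"

definition general_type :: "surf \<Rightarrow> surf \<Rightarrow> surf \<Rightarrow> (real \<times> real) set \<Rightarrow> bool" where
  "general_type z n1 n2 D \<longleftrightarrow> (\<forall>p\<in>D. (gauss_curv z p)\<^sup>2 - (normal_curv z n1 n2 p)\<^sup>2 > 0
                                   \<and> normal_curv z n1 n2 p \<noteq> 0)"

definition frx :: "surf \<Rightarrow> surf" where "frx z p = (1 / sqrt (fE z p)) *\<^sub>R pu z p"
definition fry :: "surf \<Rightarrow> surf" where "fry z p = (1 / sqrt (fG z p)) *\<^sub>R pv z p"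

definition Dx :: "surf \<Rightarrow> surf \<Rightarrow> surf" where "Dx z X p = (1 / sqrt (fE z p)) *\<^sub>R pu X p"
definition Dy :: "surf \<Rightarrow> surf \<Rightarrow> surf" where "Dy z X p = (1 / sqrt (fG z p)) *\<^sub>R pv X p"

text \<open>(z_u/sqrt E, z_v/sqrt G, n1, n2) is a geometric frame on D with invariants
  nu, mu, g1, g2, b1, b2 (semi-canonical parameters: F = 0 and parametric lines canonical).\<close>
definition geometric_frame ::
  "surf \<Rightarrow> (real \<times> real) set \<Rightarrow> surf \<Rightarrow> surf \<Rightarrow>
   (real \<times> real \<Rightarrow> real) \<Rightarrow> (real \<times> real \<Rightarrow> real) \<Rightarrow> (real \<times> real \<Rightarrow> real) \<Rightarrow>
   (real \<times> real \<Rightarrow> real) \<Rightarrow> (real \<times> real \<Rightarrow> real) \<Rightarrow> (real \<times> real \<Rightarrow> real) \<Rightarrow> bool" where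
  "geometric_frame z D n1 n2 nu mu g1 g2 b1 b2 \<longleftrightarrow>
     smooth2_on D n1 \<and> smooth2_on D n2 \<and>
     (\<forall>p\<in>D.
        (let x = frx z p; y = fry z p in
          fF z p = 0 \<and>
          x \<bullet> x = 1 \<and> y \<bullet> y = 1 \<and> n1 p \<bullet> n1 p = 1 \<and> n2 p \<bullet> n2 p = 1 \<and>
          x \<bullet> y = 0 \<and> x \<bullet> n1 p = 0 \<and> x \<bullet> n2 p = 0 \<and> y \<bullet> n1 p = 0 \<and> y \<bullet> n2 p = 0 \<and>
          n1 p \<bullet> n2 p = 0 \<and>
          det4 x y (n1 p) (n2 p) > 0 \<and>
          canonical_dir z p x \<and> canonical_dir z p y \<and>
          mu p > 0 \<and> nu p \<noteq> 0 \<and> (mu p)\<^sup>2 \<noteq> (nu p)\<^sup>2 \<and>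
          Dx z (frx z) p = g1 p *\<^sub>R y + nu p *\<^sub>R n1 p \<and>
          Dx z (fry z) p = - g1 p *\<^sub>R x + mu p *\<^sub>R n2 p \<and>
          Dy z (frx z) p = - g2 p *\<^sub>R y + mu p *\<^sub>R n2 p \<and>
          Dy z (fry z) p = g2 p *\<^sub>R x - nu p *\<^sub>R n1 p \<and>
          Dx z n1 p = - nu p *\<^sub>R x + b1 p *\<^sub>R n2 p \<and>
          Dy z n1 p = nu p *\<^sub>R y + b2 p *\<^sub>R n2 p \<and>
          Dx z n2 p = - mu p *\<^sub>R y - b1 p *\<^sub>R n1 p \<and>
          Dy z n2 p = - mu p *\<^sub>R x - b2 p *\<^sub>R n1 p))"

definition canonical_surface ::
  "surf \<Rightarrow> (real \<times> real) set \<Rightarrow> (real \<Rightarrow> real) \<Rightarrow> (real \<Rightarrow> real) \<Rightarrow> bool" where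
  "canonical_surface z D nu mu \<longleftrightarrow>
     regular_surface z D \<and> is_minimal z D \<and>
     (\<exists>n1 n2 g2 b1 b2.
        geometric_frame z D n1 n2 (\<lambda>p. nu (fst p)) (\<lambda>p. mu (fst p)) (\<lambda>p. 0) g2 b1 b2 \<and>
        general_type z n1 n2 D) \<and>
     (\<forall>p\<in>D. fE z p = 1 \<and> fF z p = 0 \<and>
        fG z p = \<bar>(mu (fst p))\<^sup>2 - (nu (fst p))\<^sup>2\<bar> powr (-1/2))"

definition open_interval :: "real set \<Rightarrow> bool" where
  "open_interval J \<longleftrightarrow> is_interval J \<and> open J \<and> J \<noteq> {}"

end

theory Submission
  imports Defs
begin

text \<open>Put \<open>s = \<surd>G\<close>, \<open>g = \<gamma>\<^sub>2\<close> and \<open>b = \<beta>\<^sub>2\<close>. Symmetry of the second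
  derivatives of \<open>z\<close> and \<open>z\<^sub>u\<close> forces \<open>\<beta>\<^sub>1 = 0\<close>, \<open>g = (ln |\<mu>\<^sup>2 - \<nu>\<^sup>2|)\<^sub>u / 4\<close> and
  \<open>b = (ln |(\<mu> + \<nu>) / (\<mu> - \<nu>)|)\<^sub>u / 2\<close>. Hence two surfaces with the same \<open>\<nu>\<close>, \<open>\<mu>\<close> have frames
  \<open>e\<^sub>k\<close>, \<open>e'\<^sub>k\<close> solving the same linear system with skew coefficients, so that
  \<open>A = \<Sum>\<^sub>k e'\<^sub>k e\<^sub>k\<^sup>T\<close> is constant, and so is \<open>z' - A z\<close>.

  For existence, the frame is written down explicitly. In the \<open>u\<close>-direction the pairs
  \<open>(x, n\<^sub>1)\<close> and \<open>(y, n\<^sub>2)\<close> rotate with angles \<open>\<phi>\<close>, \<open>\<psi>\<close>, where \<open>\<phi>' = \<nu>\<close> and \<open>\<psi>' = \<mu>\<close>.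
  The two equations of the theorem say that the vectors \<open>s (g - b, \<mu> - \<nu>)\<close> and
  \<open>s (g + b, \<mu> + \<nu>)\<close> have constant length and rotate with speeds \<open>\<mu> - \<nu>\<close> and \<open>\<mu> + \<nu>\<close>; taking
  \<open>\<psi> - \<phi>\<close> and \<open>\<psi> + \<phi>\<close> to be their polar angles fixes the initial values of \<open>\<phi>\<close>, \<open>\<psi>\<close> in such a
  way that the \<open>v\<close>-dependence becomes a pair of rotations with constant speeds \<open>\<alpha>\<close>, \<open>\<beta>\<close> in two
  fixed orthogonal planes. Such a frame integrates to a surface block by block.\<close>

section \<open>Partial derivatives in the plane\<close>

lemma pu_eqI: "((\<lambda>t. f (t, v)) has_vector_derivative d) (at u) \<Longrightarrow> pu f (u, v) = d"
  by (simp add: pu_def vector_derivative_at)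

lemma pv_eqI: "((\<lambda>t. f (u, t)) has_vector_derivative d) (at v) \<Longrightarrow> pv f (u, v) = d"
  by (simp add: pv_def vector_derivative_at)

lemma has_pu:
  assumes "f differentiable (at (u, v))"
  shows "((\<lambda>t. f (t, v)) has_vector_derivative pu f (u, v)) (at u)"
proof -
  from assms obtain f' where f': "(f has_derivative f') (at (u, v))"
    by (auto simp: differentiable_def)
  have "((\<lambda>t. f (t, v)) has_derivative (\<lambda>h. f' (h, 0))) (at u)"
    by (rule has_derivative_compose[of "\<lambda>t. (t, v)" _ u UNIV f f'])
      (auto intro!: derivative_eq_intros f')
  then have "(\<lambda>t. f (t, v)) differentiable (at u)"
    by (auto simp: differentiable_def)
  then show ?thesis
    by (simp add: pu_def vector_derivative_works)
qed

lemma has_pv: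
  assumes "f differentiable (at (u, v))"
  shows "((\<lambda>t. f (u, t)) has_vector_derivative pv f (u, v)) (at v)"
proof -
  from assms obtain f' where f': "(f has_derivative f') (at (u, v))"
    by (auto simp: differentiable_def)
  have "((\<lambda>t. f (u, t)) has_derivative (\<lambda>h. f' (0, h))) (at v)"
    by (rule has_derivative_compose[of "\<lambda>t. (u, t)" _ v UNIV f f'])
      (auto intro!: derivative_eq_intros f')
  then have "(\<lambda>t. f (u, t)) differentiable (at v)"
    by (auto simp: differentiable_def)
  then show ?thesis
    by (simp add: pv_def vector_derivative_works)
qed

lemma differentiable_comp_fst:
  fixes p :: "real \<times> real"
  assumes "(f has_real_derivative d) (at (fst p))"
  shows "(\<lambda>q. f (fst q)) differentiable (at p)"
proof -
  have "((\<lambda>q. f (fst q)) has_derivative (\<lambda>h. d * fst h)) (at p)"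
    by (rule has_derivative_compose[of fst fst p UNIV f "(*) d"])
      (use assms in \<open>auto intro!: derivative_eq_intros simp: has_field_derivative_def\<close>)
  then show ?thesis by (auto simp: differentiable_def)
qed

lemma differentiable_comp_snd:
  fixes p :: "real \<times> real"
  assumes "(f has_real_derivative d) (at (snd p))"
  shows "(\<lambda>q. f (snd q)) differentiable (at p)"
proof -
  have "((\<lambda>q. f (snd q)) has_derivative (\<lambda>h. d * snd h)) (at p)"
    by (rule has_derivative_compose[of snd snd p UNIV f "(*) d"])
      (use assms in \<open>auto intro!: derivative_eq_intros simp: has_field_derivative_def\<close>)
  then show ?thesis by (auto simp: differentiable_def)
qed

lemma open_slices:
  fixes D :: "(real \<times> real) set"
  assumes "open D" "(u, v) \<in> D"
  obtains A B where "open A" "u \<in> A" "open B" "v \<in> B" "A \<times> B \<subseteq> D"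
  using open_prod_elim[OF assms] by (metis mem_Sigma_iff)

text \<open>A slice derivative sees only nearby values, so an identity known on the open set
  \<open>D\<close> alone can still be differentiated there.\<close>

lemma pu_cong:
  assumes "open D" "p \<in> D" "\<And>q. q \<in> D \<Longrightarrow> f q = g q"
  shows "pu f p = pu g p"
proof -
  obtain u v where p: "p = (u, v)" by fastforce
  obtain A B where AB: "open A" "u \<in> A" "v \<in> B" "A \<times> B \<subseteq> D"
    using open_slices assms(1,2) p by metis
  have "\<forall>\<^sub>F t in nhds u. f (t, v) = g (t, v)"
    using AB assms(3) by (subst eventually_nhds) (intro exI[of _ A], auto)
  then show ?thesis
    unfolding p pu_def by (simp add: vector_derivative_cong_eq)
qed

lemma pv_cong:
  assumes "open D" "p \<in> D" "\<And>q. q \<in> D \<Longrightarrow> f q = g q"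
  shows "pv f p = pv g p"
proof -
  obtain u v where p: "p = (u, v)" by fastforce
  obtain A B where AB: "open B" "u \<in> A" "v \<in> B" "A \<times> B \<subseteq> D"
    using open_slices assms(1,2) p by metis
  have "\<forall>\<^sub>F t in nhds v. f (u, t) = g (u, t)"
    using AB assms(3) by (subst eventually_nhds) (intro exI[of _ B], auto)
  then show ?thesis
    unfolding p pv_def by (simp add: vector_derivative_cong_eq)
qed

lemma differentiable_cong_open:
  assumes "open D" "p \<in> D" "\<And>q. q \<in> D \<Longrightarrow> f q = g q" "g differentiable (at p)"
  shows "f differentiable (at p)"
  by (metis assms differentiable_at_withinI has_derivative_transform_within_open differentiable_def)

lemma differentiable_vec_nth:
  fixes f :: "'a::real_normed_vector \<Rightarrow> real ^ 'n"
  assumes "f differentiable F"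
  shows "(\<lambda>q. f q $ i) differentiable F"
  using assms bounded_linear.has_derivative[OF bounded_linear_vec_nth]
  unfolding differentiable_def by metis

lemma has_vector_derivative_vec_nth:
  fixes f :: "real \<Rightarrow> real ^ 'n"
  assumes "(f has_vector_derivative d) F"
  shows "((\<lambda>q. f q $ i) has_vector_derivative d $ i) F"
  using bounded_linear.has_vector_derivative[OF bounded_linear_vec_nth assms] .

lemma has_vector_derivative_vecI:
  fixes f :: "real \<Rightarrow> real ^ 'n"
  assumes "\<And>i. ((\<lambda>q. f q $ i) has_vector_derivative d $ i) (at a)"
  shows "(f has_vector_derivative d) (at a)"
  unfolding has_vector_derivative_def
  using assms
  by (subst has_derivative_componentwise_within)
    (auto simp: Basis_vec_def inner_axis has_vector_derivative_def)

lemma pu_vec_nth: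
  fixes f :: "real \<times> real \<Rightarrow> real ^ 'n"
  assumes "f differentiable (at p)"
  shows "pu (\<lambda>q. f q $ i) p = pu f p $ i"
  using assms by (cases p) (auto intro!: pu_eqI has_vector_derivative_vec_nth has_pu)

lemma pv_vec_nth:
  fixes f :: "real \<times> real \<Rightarrow> real ^ 'n"
  assumes "f differentiable (at p)"
  shows "pv (\<lambda>q. f q $ i) p = pv f p $ i"
  using assms by (cases p) (auto intro!: pv_eqI has_vector_derivative_vec_nth has_pv)

section \<open>Symmetry of mixed partial derivatives\<close>

text \<open>The mean value theorem is applied in the first variable to the difference of the top and
  bottom edges of the square, and then in the second variable to \<open>f1 u\<close>.\<close>

lemma mixed_difference_mvt:
  fixes f f1 f12 :: "real \<Rightarrow> real \<Rightarrow> real"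
  assumes h: "0 < h"
    and f1: "\<And>u v. a \<le> u \<Longrightarrow> u \<le> a + h \<Longrightarrow> b \<le> v \<Longrightarrow> v \<le> b + h \<Longrightarrow>
      ((\<lambda>t. f t v) has_real_derivative f1 u v) (at u)"
    and f12: "\<And>u v. a \<le> u \<Longrightarrow> u \<le> a + h \<Longrightarrow> b \<le> v \<Longrightarrow> v \<le> b + h \<Longrightarrow>
      (f1 u has_real_derivative f12 u v) (at v)"
  obtains u v where "a < u" "u < a + h" "b < v" "v < b + h"
    "f (a + h) (b + h) - f (a + h) b - f a (b + h) + f a b = h * h * f12 u v"
proof -
  have "\<exists>u>a. u < a + h \<and> (f (a + h) (b + h) - f (a + h) b) - (f a (b + h) - f a b)
      = (a + h - a) * (f1 u (b + h) - f1 u b)"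
    using h by (intro MVT2 DERIV_diff f1) auto
  then obtain u where u: "a < u" "u < a + h"
    "(f (a + h) (b + h) - f (a + h) b) - (f a (b + h) - f a b) = h * (f1 u (b + h) - f1 u b)"
    by auto
  have "\<exists>v>b. v < b + h \<and> f1 u (b + h) - f1 u b = (b + h - b) * f12 u v"
    using h u by (intro MVT2 f12) auto
  then obtain v where "b < v" "v < b + h" "f1 u (b + h) - f1 u b = h * f12 u v"
    by auto
  with u show thesis by (intro that[of u v]) auto
qed

text \<open>The second difference over a small square is the same in either order of the variables,
  so the two mixed derivatives agree when taken at suitable points of the square. Continuity carries
  this agreement to \<open>p\<close>.\<close>

lemma pv_pu_eq_pu_pv_real:
  fixes f :: "real \<times> real \<Rightarrow> real"
  assumes "open D" "p \<in> D"
    and diff: "\<And>q. q \<in> D \<Longrightarrow> f differentiable (at q)" "\<And>q. q \<in> D \<Longrightarrow> pu f differentiable (at q)"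
      "\<And>q. q \<in> D \<Longrightarrow> pv f differentiable (at q)"
    and cont: "isCont (pv (pu f)) p" "isCont (pu (pv f)) p"
  shows "pv (pu f) p = pu (pv f) p"
proof -
  obtain a b where p: "p = (a, b)" by fastforce
  have "\<bar>pv (pu f) p - pu (pv f) p\<bar> \<le> 2 * e" if e: "e > 0" for e
  proof -
    have "\<forall>\<^sub>F q in nhds p. q \<in> D \<and> dist (pv (pu f) q) (pv (pu f) p) < e
        \<and> dist (pu (pv f) q) (pu (pv f) p) < e"
      using assms(1,2) tendstoD[OF cont(1)[unfolded continuous_at tendsto_at_iff_tendsto_nhds] e]
        tendstoD[OF cont(2)[unfolded continuous_at tendsto_at_iff_tendsto_nhds] e]
      by (intro eventually_conj eventually_nhds_in_open) (auto simp: tendsto_at_iff_tendsto_nhds)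
    then obtain S where S: "open S" "p \<in> S"
      "\<And>q. q \<in> S \<Longrightarrow> q \<in> D \<and> dist (pv (pu f) q) (pv (pu f) p) < e
        \<and> dist (pu (pv f) q) (pu (pv f) p) < e"
      unfolding eventually_nhds by auto
    obtain A B where AB: "open A" "a \<in> A" "open B" "b \<in> B" "A \<times> B \<subseteq> S"
      using open_slices S(1,2) p by metis
    obtain d1 where d1: "d1 > 0" "\<And>t. dist t a < d1 \<Longrightarrow> t \<in> A"
      using AB by (metis open_dist)
    obtain d2 where d2: "d2 > 0" "\<And>t. dist t b < d2 \<Longrightarrow> t \<in> B"
      using AB by (metis open_dist)
    \<comment> \<open>Half of the smaller radius keeps the closed square of side \<open>h\<close>
      inside \<open>A \<times> B\<close>.\<close>
    define h where "h = min d1 d2 / 2"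
    have h: "h > 0" using d1 d2 by (simp add: h_def)
    have inS: "(u, v) \<in> S" if "a \<le> u" "u \<le> a + h" "b \<le> v" "v \<le> b + h" for u v
      using that d1 d2 AB(5) by (auto simp: h_def dist_real_def min_def split: if_splits)
    obtain u v where uv: "a < u" "u < a + h" "b < v" "v < b + h"
      "f (a + h, b + h) - f (a + h, b) - f (a, b + h) + f (a, b) = h * h * pv (pu f) (u, v)"
      by (rule mixed_difference_mvt[OF h, of a b "\<lambda>u v. f (u, v)" "\<lambda>u v. pu f (u, v)"
            "\<lambda>u v. pv (pu f) (u, v)"])
        (auto simp: has_real_derivative_iff_has_vector_derivative
          intro!: has_pu has_pv diff S(3)[THEN conjunct1] inS)
    obtain v' u' where uv': "b < v'" "v' < b + h" "a < u'" "u' < a + h"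
      "f (a + h, b + h) - f (a, b + h) - f (a + h, b) + f (a, b) = h * h * pu (pv f) (u', v')"
      by (rule mixed_difference_mvt[OF h, of b a "\<lambda>v u. f (u, v)" "\<lambda>v u. pv f (u, v)"
            "\<lambda>v u. pu (pv f) (u, v)"])
        (auto simp: has_real_derivative_iff_has_vector_derivative
          intro!: has_pu has_pv diff S(3)[THEN conjunct1] inS)
    have "h * h * pv (pu f) (u, v) = h * h * pu (pv f) (u', v')"
      using uv(5) uv'(5) by linarith
    then have "pv (pu f) (u, v) = pu (pv f) (u', v')"
      using h by simp
    moreover have "dist (pv (pu f) (u, v)) (pv (pu f) p) < e"
      using S(3)[OF inS, of u v] uv by auto
    moreover have "dist (pu (pv f) (u', v')) (pu (pv f) p) < e"
      using S(3)[OF inS, of u' v'] uv' by auto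
    ultimately show ?thesis
      by (simp add: dist_real_def)
  qed
  \<comment> \<open>With a quarter of the discrepancy as \<open>e\<close>, a positive discrepancy
    would be at most half of itself.\<close>
  note this[of "\<bar>pv (pu f) p - pu (pv f) p\<bar> / 4"]
  then show ?thesis by force
qed

lemma smooth2_onD:
  assumes "smooth2_on D f" "p \<in> D"
  shows "f differentiable (at p)" "pu f differentiable (at p)" "pv f differentiable (at p)"
    "pu (pu f) differentiable (at p)" "pv (pu f) differentiable (at p)"
    "pu (pv f) differentiable (at p)" "pv (pv f) differentiable (at p)"
  using assms(2)
    assms(1)[unfolded smooth2_on_def, THEN conjunct2, rule_format, of p "[]"]
    assms(1)[unfolded smooth2_on_def, THEN conjunct2, rule_format, of p "[True]"]
    assms(1)[unfolded smooth2_on_def, THEN conjunct2, rule_format, of p "[False]"]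
    assms(1)[unfolded smooth2_on_def, THEN conjunct2, rule_format, of p "[True, True]"]
    assms(1)[unfolded smooth2_on_def, THEN conjunct2, rule_format, of p "[False, True]"]
    assms(1)[unfolded smooth2_on_def, THEN conjunct2, rule_format, of p "[True, False]"]
    assms(1)[unfolded smooth2_on_def, THEN conjunct2, rule_format, of p "[False, False]"]
  by simp_all

lemma iter_pd_append: "iter_pd (as @ bs) f = iter_pd as (iter_pd bs f)"
  by (induction as) auto

lemma smooth2_on_pu:
  assumes "smooth2_on D f"
  shows "smooth2_on D (pu f)"
proof -
  have "iter_pd bs (pu f) = iter_pd (bs @ [True]) f" for bs
    by (simp add: iter_pd_append)
  then show ?thesis
    using assms by (simp add: smooth2_on_def del: iter_pd.simps)
qed

text \<open>Each coordinate reduces to the real case: smoothness makes the mixed derivatives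
  differentiable, hence continuous.\<close>

lemma pv_pu_eq_pu_pv:
  fixes f :: "real \<times> real \<Rightarrow> real ^ 'n"
  assumes "smooth2_on D f" "p \<in> D"
  shows "pv (pu f) p = pu (pv f) p"
proof (subst vec_eq_iff, intro allI)
  fix i
  let ?g = "\<lambda>q. f q $ i"
  have D: "open D" using assms by (simp add: smooth2_on_def)
  note d = smooth2_onD[OF assms(1)]
  have g1: "pu ?g q = pu f q $ i" "pv ?g q = pv f q $ i" if "q \<in> D" for q
    using that d by (simp_all add: pu_vec_nth pv_vec_nth)
  have dg: "pu ?g differentiable (at q)" "pv ?g differentiable (at q)" if "q \<in> D" for q
    using that d
      differentiable_cong_open[OF D that, of "pu ?g" "\<lambda>q. pu f q $ i"]
      differentiable_cong_open[OF D that, of "pv ?g" "\<lambda>q. pv f q $ i"]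
    by (simp_all add: g1 differentiable_vec_nth)
  have g2: "pv (pu ?g) q = pv (pu f) q $ i" "pu (pv ?g) q = pu (pv f) q $ i" if "q \<in> D" for q
  proof -
    have "pv (pu ?g) q = pv (\<lambda>q. pu f q $ i) q" "pu (pv ?g) q = pu (\<lambda>q. pv f q $ i) q"
      using g1 that by (auto intro: pv_cong[OF D] pu_cong[OF D])
    then show "pv (pu ?g) q = pv (pu f) q $ i" "pu (pv ?g) q = pu (pv f) q $ i"
      using d that by (simp_all add: pu_vec_nth pv_vec_nth)
  qed
  have "isCont (pv (pu ?g)) p" "isCont (pu (pv ?g)) p"
    using assms(2) d
      differentiable_cong_open[OF D assms(2), of "pv (pu ?g)" "\<lambda>q. pv (pu f) q $ i"]
      differentiable_cong_open[OF D assms(2), of "pu (pv ?g)" "\<lambda>q. pu (pv f) q $ i"]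
    by (simp_all add: g2 differentiable_vec_nth differentiable_imp_continuous_within)
  then have "pv (pu ?g) p = pu (pv ?g) p"
    using assms(2) d dg
    by (intro pv_pu_eq_pu_pv_real[OF D]) (auto intro!: differentiable_vec_nth)
  then show "pv (pu f) p $ i = pu (pv f) p $ i"
    using g2 assms(2) by simp
qed

section \<open>Smoothness from a differentially closed algebra of functions\<close>

text \<open>Iterated partial derivatives need not be computed: smoothness follows once the first partial
  derivatives of the generators \<open>B\<close> are, on \<open>D\<close>, polynomials in the generators.\<close>

inductive_set palg :: "(real \<times> real) set \<Rightarrow> (real \<times> real \<Rightarrow> real) set \<Rightarrow> (real \<times> real \<Rightarrow> real) set"
  for D B where
  base: "f \<in> B \<Longrightarrow> f \<in> palg D B"
| const: "(\<lambda>_. c) \<in> palg D B"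
| add: "f \<in> palg D B \<Longrightarrow> g \<in> palg D B \<Longrightarrow> (\<lambda>p. f p + g p) \<in> palg D B"
| mult: "f \<in> palg D B \<Longrightarrow> g \<in> palg D B \<Longrightarrow> (\<lambda>p. f p * g p) \<in> palg D B"
| cong: "f \<in> palg D B \<Longrightarrow> (\<And>p. p \<in> D \<Longrightarrow> g p = f p) \<Longrightarrow> g \<in> palg D B"

lemma palg_minus: "f \<in> palg D B \<Longrightarrow> (\<lambda>p. - f p) \<in> palg D B"
  using palg.mult[OF palg.const[of "-1"]] by simp

lemma palg_diff: "f \<in> palg D B \<Longrightarrow> g \<in> palg D B \<Longrightarrow> (\<lambda>p. f p - g p) \<in> palg D B"
  using palg.add[OF _ palg_minus] by simp

lemma palg_power2: "f \<in> palg D B \<Longrightarrow> (\<lambda>p. (f p)\<^sup>2) \<in> palg D B"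
  unfolding power2_eq_square by (rule palg.mult)

text \<open>The sum and product rules carry closure from the generators to all polynomials in them.
  These rules hold on \<open>D\<close> only, which is why the algebra is closed under changes
  outside \<open>D\<close>.\<close>

lemma palg_closed:
  assumes D: "open D"
    and B: "\<And>f p. f \<in> B \<Longrightarrow> p \<in> D \<Longrightarrow> f differentiable (at p)"
      "\<And>f. f \<in> B \<Longrightarrow> pu f \<in> palg D B" "\<And>f. f \<in> B \<Longrightarrow> pv f \<in> palg D B"
    and "f \<in> palg D B"
  shows "(\<forall>p\<in>D. f differentiable (at p)) \<and> pu f \<in> palg D B \<and> pv f \<in> palg D B"
  using assms(5)
proof induction
  case (base f)
  then show ?case using B by auto
next
  case (const c)
  have "pu (\<lambda>_. c) = (\<lambda>_. 0)" "pv (\<lambda>_. c) = (\<lambda>_. 0)"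
    by (auto intro!: pu_eqI pv_eqI)
  then show ?case by (auto intro: palg.const)
next
  case (add f g)
  have "pu (\<lambda>p. f p + g p) p = pu f p + pu g p" "pv (\<lambda>p. f p + g p) p = pv f p + pv g p"
    if "p \<in> D" for p
    using that add by (cases p; auto intro!: pu_eqI pv_eqI has_vector_derivative_add has_pu has_pv)+
  moreover have "(\<lambda>p. pu f p + pu g p) \<in> palg D B" "(\<lambda>p. pv f p + pv g p) \<in> palg D B"
    using add by - (intro palg.add, simp_all)+
  ultimately have "pu (\<lambda>p. f p + g p) \<in> palg D B" "pv (\<lambda>p. f p + g p) \<in> palg D B"
    by (metis (no_types, lifting) palg.cong)+
  then show ?case using add by simp
next
  case (mult f g)
  have "pu (\<lambda>p. f p * g p) p = f p * pu g p + pu f p * g p"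
    "pv (\<lambda>p. f p * g p) p = f p * pv g p + pv f p * g p"
    if "p \<in> D" for p
    using that mult by (cases p; auto intro!: pu_eqI pv_eqI has_vector_derivative_mult has_pu has_pv)+
  moreover have "(\<lambda>p. f p * pu g p + pu f p * g p) \<in> palg D B"
    "(\<lambda>p. f p * pv g p + pv f p * g p) \<in> palg D B"
    using mult by - (intro palg.add palg.mult, simp_all)+
  ultimately have "pu (\<lambda>p. f p * g p) \<in> palg D B" "pv (\<lambda>p. f p * g p) \<in> palg D B"
    by (metis (no_types, lifting) palg.cong)+
  then show ?case using mult by simp
next
  case (cong f g)
  have "pu g p = pu f p" "pv g p = pv f p" if "p \<in> D" for p
    using cong that by (auto intro: pu_cong[OF D] pv_cong[OF D])
  moreover have "g differentiable (at p)" if "p \<in> D" for p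
    using differentiable_cong_open[OF D that, of g f] cong that by auto
  ultimately show ?case using cong
    by (auto intro: palg.cong)
qed

text \<open>Induction on the word of derivatives keeps every component inside the algebra, all of
  whose members are differentiable on \<open>D\<close>.\<close>

lemma smooth2_on_palg:
  fixes z :: "real \<times> real \<Rightarrow> real ^ 'n"
  assumes D: "open D"
    and B: "\<And>f p. f \<in> B \<Longrightarrow> p \<in> D \<Longrightarrow> f differentiable (at p)"
      "\<And>f. f \<in> B \<Longrightarrow> pu f \<in> palg D B" "\<And>f. f \<in> B \<Longrightarrow> pv f \<in> palg D B"
    and z: "\<And>i. (\<lambda>p. z p $ i) \<in> palg D B"
  shows "smooth2_on D z"
proof -
  have closed: "(\<forall>p\<in>D. f differentiable (at p)) \<and> pu f \<in> palg D B \<and> pv f \<in> palg D B"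
    if "f \<in> palg D B" for f
    using palg_closed[of D B f] D B that by blast
  have diff: "w differentiable (at p)" if "\<And>i. (\<lambda>p. w p $ i) \<in> palg D B" "p \<in> D"
    for w :: "real \<times> real \<Rightarrow> real ^ 'n" and p
    using that closed
    by (subst differentiable_componentwise_within) (auto simp: Basis_vec_def inner_axis)
  have "(\<lambda>p. iter_pd bs z p $ i) \<in> palg D B" for bs i
  proof (induction bs arbitrary: i)
    case Nil
    then show ?case using z by simp
  next
    case (Cons b bs)
    let ?w = "iter_pd bs z"
    have "pu ?w p $ i = pu (\<lambda>p. ?w p $ i) p" "pv ?w p $ i = pv (\<lambda>p. ?w p $ i) p" if "p \<in> D" for p
      using that Cons by (simp_all add: pu_vec_nth pv_vec_nth diff)
    then have "(\<lambda>p. pu ?w p $ i) \<in> palg D B" "(\<lambda>p. pv ?w p $ i) \<in> palg D B"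
      using closed[OF Cons[of i]] by (metis (no_types, lifting) palg.cong)+
    then show ?case
      by simp
  qed
  then show ?thesis
    using diff D by (auto simp: smooth2_on_def)
qed

section \<open>Surfaces with an adapted frame\<close>

text \<open>This is the Leibniz sum, with the permutations of the indices enumerated by adjoining
  one index at a time.\<close>

lemma det_4:
  "det (A :: real^4^4) =
     A$1$1 * A$2$2 * A$3$3 * A$4$4 - A$1$1 * A$2$2 * A$3$4 * A$4$3
   - A$1$1 * A$2$3 * A$3$2 * A$4$4 + A$1$1 * A$2$3 * A$3$4 * A$4$2
   + A$1$1 * A$2$4 * A$3$2 * A$4$3 - A$1$1 * A$2$4 * A$3$3 * A$4$2
   - A$1$2 * A$2$1 * A$3$3 * A$4$4 + A$1$2 * A$2$1 * A$3$4 * A$4$3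
   + A$1$2 * A$2$3 * A$3$1 * A$4$4 - A$1$2 * A$2$3 * A$3$4 * A$4$1
   - A$1$2 * A$2$4 * A$3$1 * A$4$3 + A$1$2 * A$2$4 * A$3$3 * A$4$1
   + A$1$3 * A$2$1 * A$3$2 * A$4$4 - A$1$3 * A$2$1 * A$3$4 * A$4$2
   - A$1$3 * A$2$2 * A$3$1 * A$4$4 + A$1$3 * A$2$2 * A$3$4 * A$4$1
   + A$1$3 * A$2$4 * A$3$1 * A$4$2 - A$1$3 * A$2$4 * A$3$2 * A$4$1
   - A$1$4 * A$2$1 * A$3$2 * A$4$3 + A$1$4 * A$2$1 * A$3$3 * A$4$2
   + A$1$4 * A$2$2 * A$3$1 * A$4$3 - A$1$4 * A$2$2 * A$3$3 * A$4$1
   - A$1$4 * A$2$3 * A$3$1 * A$4$2 + A$1$4 * A$2$3 * A$3$2 * A$4$1"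
proof -
  have f: "finite {2::4, 3, 4}" "1 \<notin> {2::4, 3, 4}" "finite {3::4, 4}" "2 \<notin> {3::4, 4}"
    "finite {4::4}" "3 \<notin> {4::4}"
    by auto
  show ?thesis
    unfolding det_def UNIV_4
    unfolding sum_over_permutations_insert[OF f(1,2)] sum_over_permutations_insert[OF f(3,4)]
      sum_over_permutations_insert[OF f(5,6)]
    unfolding permutes_sing
    by (simp add: sign_swap_id permutation_swap_id permutation_compose sign_compose sign_id swap_id_eq)
qed

lemma vector_4:
  "(vector [w, x, y, z] :: 'a::zero^4) $ 1 = w"
  "(vector [w, x, y, z] :: 'a::zero^4) $ 2 = x"
  "(vector [w, x, y, z] :: 'a::zero^4) $ 3 = y"
  "(vector [w, x, y, z] :: 'a::zero^4) $ 4 = z"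
  unfolding vector_def by simp_all

lemma det4_scale2: "det4 a (c *\<^sub>R b) d e = c * det4 a b d e"
  by (simp add: det4_def det_4 vector_4 algebra_simps)

section \<open>The profile equations and the moving frame\<close>

text \<open>The two second-order equations are kept as a first-order system: \<open>nu_deriv\<close>
  and \<open>mu_deriv\<close> are the logarithmic formulas for \<open>g\<close> and \<open>b\<close>
  solved for the derivatives of \<open>nu\<close> and \<open>mu\<close>, while
  \<open>g_deriv\<close> and \<open>b_deriv\<close> are the equations themselves. The right-hand
  sides are polynomial, which the smoothness argument exploits.\<close>

locale profile =
  fixes J :: "real set" and nu mu g b s :: "real \<Rightarrow> real"
  assumes J: "open_interval J"
    and nu_deriv: "u \<in> J \<Longrightarrow> (nu has_real_derivative 2 * g u * nu u + b u * mu u) (at u)"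
    and mu_deriv: "u \<in> J \<Longrightarrow> (mu has_real_derivative 2 * g u * mu u + b u * nu u) (at u)"
    and g_deriv: "u \<in> J \<Longrightarrow> (g has_real_derivative (g u)\<^sup>2 - (mu u)\<^sup>2 - (nu u)\<^sup>2) (at u)"
    and b_deriv: "u \<in> J \<Longrightarrow> (b has_real_derivative g u * b u - 2 * mu u * nu u) (at u)"
    and s_deriv: "u \<in> J \<Longrightarrow> (s has_real_derivative - g u * s u) (at u)"
    and s_pos: "u \<in> J \<Longrightarrow> s u > 0"
    and s_square: "u \<in> J \<Longrightarrow> s u * s u = \<bar>(mu u)\<^sup>2 - (nu u)\<^sup>2\<bar> powr (-1/2)"
    and mu_pos: "u \<in> J \<Longrightarrow> mu u > 0"
    and nu_nz: "u \<in> J \<Longrightarrow> nu u \<noteq> 0"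
    and sq_ne: "u \<in> J \<Longrightarrow> (mu u)\<^sup>2 \<noteq> (nu u)\<^sup>2"

text \<open>These are the frame equations with
  \<open>\<gamma>\<^sub>1 = \<beta>\<^sub>1 = 0\<close>, multiplied by \<open>\<surd>E = 1\<close>
  in the \<open>u\<close>-direction and by \<open>\<surd>G = s\<close> in the
  \<open>v\<close>-direction. Only first derivatives along slices are recorded, so the same
  interface serves a given surface and a constructed one.\<close>

locale adapted_frame = profile +
  fixes J' :: "real set" and z x y n1 n2 :: surf
  assumes J': "open_interval J'"
    and orthonormal: "p \<in> J \<times> J' \<Longrightarrow>
      x p \<bullet> x p = 1 \<and> y p \<bullet> y p = 1 \<and> n1 p \<bullet> n1 p = 1 \<and> n2 p \<bullet> n2 p = 1 \<and>
      x p \<bullet> y p = 0 \<and> x p \<bullet> n1 p = 0 \<and> x p \<bullet> n2 p = 0 \<and> y p \<bullet> n1 p = 0 \<and> y p \<bullet> n2 p = 0 \<and>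
      n1 p \<bullet> n2 p = 0"
    and det_pos: "p \<in> J \<times> J' \<Longrightarrow> det4 (x p) (y p) (n1 p) (n2 p) > 0"
    and z_u: "u \<in> J \<Longrightarrow> v \<in> J' \<Longrightarrow> ((\<lambda>t. z (t, v)) has_vector_derivative x (u, v)) (at u)"
    and z_v: "u \<in> J \<Longrightarrow> v \<in> J' \<Longrightarrow> ((\<lambda>t. z (u, t)) has_vector_derivative s u *\<^sub>R y (u, v)) (at v)"
    and x_u: "u \<in> J \<Longrightarrow> v \<in> J' \<Longrightarrow>
      ((\<lambda>t. x (t, v)) has_vector_derivative nu u *\<^sub>R n1 (u, v)) (at u)"
    and y_u: "u \<in> J \<Longrightarrow> v \<in> J' \<Longrightarrow>
      ((\<lambda>t. y (t, v)) has_vector_derivative mu u *\<^sub>R n2 (u, v)) (at u)"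
    and n1_u: "u \<in> J \<Longrightarrow> v \<in> J' \<Longrightarrow>
      ((\<lambda>t. n1 (t, v)) has_vector_derivative - nu u *\<^sub>R x (u, v)) (at u)"
    and n2_u: "u \<in> J \<Longrightarrow> v \<in> J' \<Longrightarrow>
      ((\<lambda>t. n2 (t, v)) has_vector_derivative - mu u *\<^sub>R y (u, v)) (at u)"
    and x_v: "u \<in> J \<Longrightarrow> v \<in> J' \<Longrightarrow> ((\<lambda>t. x (u, t)) has_vector_derivative
      s u *\<^sub>R (- g u *\<^sub>R y (u, v) + mu u *\<^sub>R n2 (u, v))) (at v)"
    and y_v: "u \<in> J \<Longrightarrow> v \<in> J' \<Longrightarrow> ((\<lambda>t. y (u, t)) has_vector_derivative
      s u *\<^sub>R (g u *\<^sub>R x (u, v) - nu u *\<^sub>R n1 (u, v))) (at v)"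
    and n1_v: "u \<in> J \<Longrightarrow> v \<in> J' \<Longrightarrow> ((\<lambda>t. n1 (u, t)) has_vector_derivative
      s u *\<^sub>R (nu u *\<^sub>R y (u, v) + b u *\<^sub>R n2 (u, v))) (at v)"
    and n2_v: "u \<in> J \<Longrightarrow> v \<in> J' \<Longrightarrow> ((\<lambda>t. n2 (u, t)) has_vector_derivative
      s u *\<^sub>R (- mu u *\<^sub>R x (u, v) - b u *\<^sub>R n1 (u, v))) (at v)"
begin

abbreviation D where "D \<equiv> J \<times> J'"

text \<open>Coordinates with respect to the moving frame reduce the geometry of this part to scalar
  arithmetic.\<close>

definition comb :: "real \<times> real \<Rightarrow> real \<Rightarrow> real \<Rightarrow> real \<Rightarrow> real \<Rightarrow> real^4" where
  "comb p c1 c2 c3 c4 = c1 *\<^sub>R x p + c2 *\<^sub>R y p + c3 *\<^sub>R n1 p + c4 *\<^sub>R n2 p"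

lemma open_D: "open D"
  using J J' by (auto simp: open_interval_def intro: open_Times)

lemma comb_inner:
  "p \<in> D \<Longrightarrow> comb p c1 c2 c3 c4 \<bullet> comb p d1 d2 d3 d4 = c1 * d1 + c2 * d2 + c3 * d3 + c4 * d4"
  using orthonormal[of p]
  by (simp add: comb_def inner_add_left inner_add_right inner_commute[of "y p" "x p"]
      inner_commute[of "n1 p" "x p"] inner_commute[of "n2 p" "x p"] inner_commute[of "n1 p" "y p"]
      inner_commute[of "n2 p" "y p"] inner_commute[of "n2 p" "n1 p"])

lemma comb_scale: "k *\<^sub>R comb p c1 c2 c3 c4 = comb p (k * c1) (k * c2) (k * c3) (k * c4)"
  by (simp add: comb_def scaleR_add_right)

lemma comb_add:
  "comb p c1 c2 c3 c4 + comb p d1 d2 d3 d4 = comb p (c1 + d1) (c2 + d2) (c3 + d3) (c4 + d4)"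
  by (simp add: comb_def scaleR_add_left)

lemma comb_diff:
  "comb p c1 c2 c3 c4 - comb p d1 d2 d3 d4 = comb p (c1 - d1) (c2 - d2) (c3 - d3) (c4 - d4)"
  by (simp add: comb_def scaleR_diff_left)

lemma comb_zero: "comb p 0 0 0 0 = 0"
  by (simp add: comb_def)

lemma frame_eq_comb:
  "x p = comb p 1 0 0 0" "y p = comb p 0 1 0 0" "n1 p = comb p 0 0 1 0" "n2 p = comb p 0 0 0 1"
  by (simp_all add: comb_def)

text \<open>The product rule is combined with the rotations of the pairs \<open>(x, n1)\<close> and
  \<open>(y, n2)\<close>. The coefficients depend on \<open>u\<close> alone, so in the companion
  rule for \<open>v\<close> only the frame is differentiated.\<close>

lemma pu_comb:
  assumes f: "\<And>q. q \<in> D \<Longrightarrow> f q = comb q (c1 (fst q)) (c2 (fst q)) (c3 (fst q)) (c4 (fst q))"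
    and p: "p \<in> D"
    and c: "(c1 has_real_derivative d1) (at (fst p))" "(c2 has_real_derivative d2) (at (fst p))"
      "(c3 has_real_derivative d3) (at (fst p))" "(c4 has_real_derivative d4) (at (fst p))"
  shows "pu f p = comb p (d1 - nu (fst p) * c3 (fst p)) (d2 - mu (fst p) * c4 (fst p))
    (d3 + nu (fst p) * c1 (fst p)) (d4 + mu (fst p) * c2 (fst p))"
proof -
  obtain u v where uv: "p = (u, v)" "u \<in> J" "v \<in> J'" using p by auto
  have "pu f p = pu (\<lambda>q. comb q (c1 (fst q)) (c2 (fst q)) (c3 (fst q)) (c4 (fst q))) p"
    by (rule pu_cong[OF open_D p]) (rule f)
  also have "\<dots> = comb p (d1 - nu u * c3 u) (d2 - mu u * c4 u)
    (d3 + nu u * c1 u) (d4 + mu u * c2 u)"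
    unfolding uv(1)
    using c x_u[OF uv(2,3)] y_u[OF uv(2,3)] n1_u[OF uv(2,3)] n2_u[OF uv(2,3)]
    by (intro pu_eqI)
      (auto simp: comb_def uv(1) algebra_simps intro!: derivative_eq_intros)
  finally show ?thesis by (simp add: uv(1))
qed

lemma pv_comb:
  assumes f: "\<And>q. q \<in> D \<Longrightarrow> f q = comb q (c1 (fst q)) (c2 (fst q)) (c3 (fst q)) (c4 (fst q))"
    and p: "p \<in> D" "u = fst p"
  shows "pv f p = comb p (s u * (g u * c2 u - mu u * c4 u)) (s u * (nu u * c3 u - g u * c1 u))
    (s u * (- nu u * c2 u - b u * c4 u)) (s u * (mu u * c1 u + b u * c3 u))"
proof -
  obtain v where uv: "p = (u, v)" "u \<in> J" "v \<in> J'" using p by auto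
  have "pv f p = pv (\<lambda>q. comb q (c1 (fst q)) (c2 (fst q)) (c3 (fst q)) (c4 (fst q))) p"
    by (rule pv_cong[OF open_D p(1)]) (rule f)
  also have "\<dots> = comb p (s u * (g u * c2 u - mu u * c4 u)) (s u * (nu u * c3 u - g u * c1 u))
    (s u * (- nu u * c2 u - b u * c4 u)) (s u * (mu u * c1 u + b u * c3 u))"
    unfolding uv(1)
    using x_v[OF uv(2,3)] y_v[OF uv(2,3)] n1_v[OF uv(2,3)] n2_v[OF uv(2,3)]
    by (intro pv_eqI)
      (auto simp: comb_def uv(1) algebra_simps intro!: derivative_eq_intros)
  finally show ?thesis .
qed

lemma pu_comb_const:
  assumes "\<And>q. q \<in> D \<Longrightarrow> f q = comb q k1 k2 k3 k4" "p \<in> D"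
  shows "pu f p = comb p (- nu (fst p) * k3) (- mu (fst p) * k4) (nu (fst p) * k1) (mu (fst p) * k2)"
  using pu_comb[of f "\<lambda>_. k1" "\<lambda>_. k2" "\<lambda>_. k3" "\<lambda>_. k4" p 0 0 0 0] assms by simp

lemma pv_comb_const:
  assumes "\<And>q. q \<in> D \<Longrightarrow> f q = comb q k1 k2 k3 k4" "p \<in> D" "u = fst p"
  shows "pv f p = comb p (s u * (g u * k2 - mu u * k4)) (s u * (nu u * k3 - g u * k1))
    (s u * (- nu u * k2 - b u * k4)) (s u * (mu u * k1 + b u * k3))"
  using pv_comb[of f "\<lambda>_. k1" "\<lambda>_. k2" "\<lambda>_. k3" "\<lambda>_. k4" p u] assms by simp

section \<open>First and second fundamental forms\<close>

lemma pu_z: "p \<in> D \<Longrightarrow> pu z p = comb p 1 0 0 0"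
  by (cases p) (auto simp: comb_def intro!: pu_eqI z_u)

lemma pv_z: "p \<in> D \<Longrightarrow> pv z p = comb p 0 (s (fst p)) 0 0"
  by (cases p) (auto simp: comb_def intro!: pv_eqI z_v)

lemma fEFG:
  assumes "p \<in> D"
  shows "fE z p = 1" "fF z p = 0" "fG z p = s (fst p) * s (fst p)" "gram z p = s (fst p) * s (fst p)"
  using assms by (simp_all add: fE_def fF_def fG_def gram_def pu_z pv_z comb_inner)

lemma s_pos_D: "p \<in> D \<Longrightarrow> s (fst p) > 0"
  using s_pos by auto

lemma tcoord_comb: "p \<in> D \<Longrightarrow> tcoord z p (comb p c1 c2 c3 c4) = (c1, c2 / s (fst p))"
  using s_pos_D[of p] by (simp add: tcoord_def fEFG pu_z pv_z comb_inner)

lemma tproj_comb: "p \<in> D \<Longrightarrow> tproj z p (comb p c1 c2 c3 c4) = comb p c1 c2 0 0"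
  using s_pos_D[of p] by (simp add: tproj_def tcoord_comb pu_z pv_z comb_scale comb_add)

lemma nproj_comb: "p \<in> D \<Longrightarrow> nproj z p (comb p c1 c2 c3 c4) = comb p 0 0 c3 c4"
  by (simp add: nproj_def tproj_comb comb_diff)

text \<open>The mixed derivatives are computed in both orders; they agree because \<open>s\<close>
  has derivative \<open>- g u * s u\<close>.\<close>

lemma second_derivs:
  assumes "p \<in> D" "u = fst p"
  shows "pu (pu z) p = comb p 0 0 (nu u) 0"
    "pv (pu z) p = comb p 0 (- s u * g u) 0 (s u * mu u)"
    "pu (pv z) p = comb p 0 (- s u * g u) 0 (s u * mu u)"
    "pv (pv z) p = comb p (s u * (g u * s u)) 0 (s u * (- nu u * s u)) 0"
proof -
  have "u \<in> J" using assms by auto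
  show "pu (pu z) p = comb p 0 0 (nu u) 0"
    using pu_comb_const[OF pu_z, of p] assms by simp
  show "pv (pu z) p = comb p 0 (- s u * g u) 0 (s u * mu u)"
    using pv_comb_const[OF pu_z, of p u] assms by simp
  show "pu (pv z) p = comb p 0 (- s u * g u) 0 (s u * mu u)"
    using pu_comb[OF pv_z, where ?d1.0 = 0 and ?d2.0 = "- g u * s u" and ?d3.0 = 0 and ?d4.0 = 0
        and p = p] assms s_deriv[OF \<open>u \<in> J\<close>] by (simp add: mult.commute)
  show "pv (pv z) p = comb p (s u * (g u * s u)) 0 (s u * (- nu u * s u)) 0"
    using pv_comb[OF pv_z, of p u] assms by simp
qed

text \<open>By bilinearity this follows from \<sigma>(x,x) = \<nu> n1, \<sigma>(y,y) = - \<nu> n1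
  and \<sigma>(x,y) = \<mu> n2.\<close>

lemma sff_comb:
  assumes "p \<in> D"
  shows "sff z p (comb p a c 0 0) (comb p a' c' 0 0) =
    comb p 0 0 ((a * a' - c * c') * nu (fst p)) ((a * c' + c * a') * mu (fst p))"
  using assms s_pos_D[OF assms]
  by (simp add: sff_def tcoord_comb second_derivs comb_scale comb_add nproj_comb)
    (simp add: field_simps)

lemma tangent_space_eq: "p \<in> D \<Longrightarrow> tangent_space z p = {comb p a c 0 0 |a c. True}"
proof -
  assume p: "p \<in> D"
  have "(w \<in> tangent_space z p) \<longleftrightarrow> (\<exists>k l. w = k *\<^sub>R pu z p + l *\<^sub>R pv z p)" for w
    unfolding tangent_space_def span_insert[of "pu z p"] span_singleton
    by (auto simp: image_iff algebra_simps)
  also have "(\<exists>k l. w = k *\<^sub>R pu z p + l *\<^sub>R pv z p) \<longleftrightarrow> (\<exists>a c. w = comb p a c 0 0)" for w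
  proof -
    have "k *\<^sub>R pu z p + l *\<^sub>R pv z p = comb p k (l * s (fst p)) 0 0" for k l
      using p by (simp add: pu_z pv_z comb_scale comb_add)
    moreover have "comb p a c 0 0 = comb p a (c / s (fst p) * s (fst p)) 0 0" for a c
      using s_pos_D[OF p] by simp
    ultimately show ?thesis by metis
  qed
  finally show ?thesis by auto
qed

section \<open>The ellipse of curvature and minimality\<close>

text \<open>The opposite vectors \<sigma>(x,x) and \<sigma>(y,y) cancel, so distances from the
  centre become norms of \<sigma>.\<close>

lemma center_zero: "p \<in> D \<Longrightarrow> ellipse_center z p = 0"
  by (simp add: ellipse_center_def fEFG pu_z pv_z sff_comb comb_scale comb_diff comb_add)
    (simp add: comb_zero)

lemma norm_comb_le:
  assumes "p \<in> D"
  shows "norm (comb p c1 c2 c3 c4) \<le> norm (comb p d1 d2 d3 d4) \<longleftrightarrow>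
    c1\<^sup>2 + c2\<^sup>2 + c3\<^sup>2 + c4\<^sup>2 \<le> d1\<^sup>2 + d2\<^sup>2 + d3\<^sup>2 + d4\<^sup>2"
  using assms by (simp add: norm_le comb_inner power2_eq_square)

text \<open>For a unit vector with coordinates \<open>a\<close>, \<open>c\<close> the squared norm
  of \<sigma> is \<open>nu\<^sup>2 + 4 * (a * c)\<^sup>2 * (mu\<^sup>2 - nu\<^sup>2)\<close>. At the
  frame directions \<open>a * c = 0\<close>, and this value is a minimum or a maximum according to
  the sign of the last factor.\<close>

lemma canonical_dirs:
  assumes p: "p \<in> D" and w: "w = comb p 1 0 0 0 \<or> w = comb p 0 1 0 0"
  shows "canonical_dir z p w"
proof -
  let ?n = "nu (fst p)" and ?m = "mu (fst p)"
  have *: "((a * a - c * c) * ?n)\<^sup>2 + ((a * c + c * a) * ?m)\<^sup>2 = ?n\<^sup>2 + 4 * (a * c)\<^sup>2 * (?m\<^sup>2 - ?n\<^sup>2)"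
    if "a * a + c * c = 1" for a c
  proof -
    have "((a * a - c * c) * ?n)\<^sup>2 + ((a * c + c * a) * ?m)\<^sup>2
      = (a * a + c * c)\<^sup>2 * ?n\<^sup>2 + 4 * (a * c)\<^sup>2 * (?m\<^sup>2 - ?n\<^sup>2)"
      by (simp add: power2_eq_square algebra_simps)
    then show ?thesis using that by simp
  qed
  have "(\<forall>a c. a * a + c * c = 1 \<longrightarrow> ((a * a - c * c) * ?n)\<^sup>2 + ((a * c + c * a) * ?m)\<^sup>2 \<le> ?n\<^sup>2)
    \<or> (\<forall>a c. a * a + c * c = 1 \<longrightarrow> ?n\<^sup>2 \<le> ((a * a - c * c) * ?n)\<^sup>2 + ((a * c + c * a) * ?m)\<^sup>2)"
  proof (cases "?m\<^sup>2 \<le> ?n\<^sup>2")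
    case True
    then show ?thesis using * by (auto simp: mult_nonneg_nonpos)
  next
    case False
    then show ?thesis using * by auto
  qed
  then show ?thesis
    using w p unfolding canonical_dir_def
    by (auto simp: tangent_space_eq center_zero comb_inner sff_comb norm_comb_le)
qed

lemma minimal: "is_minimal z D"
proof -
  have "sff z p X X + sff z p Y Y = 0"
    if p: "p \<in> D" and X: "X \<in> tangent_space z p" and Y: "Y \<in> tangent_space z p"
      and n: "X \<bullet> X = 1" "Y \<bullet> Y = 1" "X \<bullet> Y = 0" for p X Y
  proof -
    obtain a c where X: "X = comb p a c 0 0" using X p by (auto simp: tangent_space_eq)
    obtain a' c' where Y: "Y = comb p a' c' 0 0" using Y p by (auto simp: tangent_space_eq)
    have e: "a * a + c * c = 1" "a' * a' + c' * c' = 1" "a * a' + c * c' = 0"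
      using n p by (simp_all add: X Y comb_inner)
    \<comment> \<open>The matrix with rows \<open>(a, c)\<close> and \<open>(a', c')\<close> is
      orthogonal, so its columns have equal length and are perpendicular.\<close>
    have "a * a - c * c + (a' * a' - c' * c') = 0" "2 * (a * c) + 2 * (a' * c') = 0"
      using e by algebra+
    then have "(a * a - c * c) * nu (fst p) + (a' * a' - c' * c') * nu (fst p) = 0"
      "(a * c + c * a) * mu (fst p) + (a' * c' + c' * a') * mu (fst p) = 0"
      by algebra+
    then show ?thesis
      using p by (simp add: X Y sff_comb comb_add comb_zero)
  qed
  then show ?thesis by (simp add: is_minimal_def)
qed

section \<open>Gauss curvature and normal curvature\<close>

text \<open>The tangential derivatives give K = g' - g^2, and \<open>g_deriv\<close> turns this into
  the Gauss equation.\<close>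

lemma gauss_curv_eq:
  assumes p: "p \<in> D"
  shows "gauss_curv z p = - ((mu (fst p))\<^sup>2 + (nu (fst p))\<^sup>2)"
proof -
  let ?u = "fst p"
  have u: "?u \<in> J" using p by auto
  have "pu (\<lambda>q. tproj z q (pv (pv z) q)) p
    = comb p ((- g ?u * s ?u * (g ?u * s ?u)
        + (((g ?u)\<^sup>2 - (mu ?u)\<^sup>2 - (nu ?u)\<^sup>2) * s ?u + - g ?u * s ?u * g ?u) * s ?u)
        - nu ?u * 0) (0 - mu ?u * 0) (0 + nu ?u * (s ?u * (g ?u * s ?u))) (0 + mu ?u * 0)"
    by (rule pu_comb[OF _ p, where ?c1.0 = "\<lambda>u. s u * (g u * s u)" and ?c2.0 = "\<lambda>_. 0"
          and ?c3.0 = "\<lambda>_. 0" and ?c4.0 = "\<lambda>_. 0"])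
      (auto simp: second_derivs tproj_comb intro!: derivative_eq_intros s_deriv[OF u] g_deriv[OF u])
  moreover have "pv (\<lambda>q. tproj z q (pu (pv z) q)) p
    = comb p (s ?u * (g ?u * (- s ?u * g ?u) - mu ?u * 0)) (s ?u * (nu ?u * 0 - g ?u * 0))
    (s ?u * (- nu ?u * (- s ?u * g ?u) - b ?u * 0)) (s ?u * (mu ?u * 0 + b ?u * 0))"
    by (rule pv_comb[OF _ p, where ?c1.0 = "\<lambda>_. 0" and ?c2.0 = "\<lambda>u. - s u * g u"
          and ?c3.0 = "\<lambda>_. 0" and ?c4.0 = "\<lambda>_. 0"])
      (auto simp: second_derivs tproj_comb)
  ultimately show ?thesis
    using p s_pos[OF u]
    by (simp add: gauss_curv_def fEFG pu_z tproj_comb comb_diff comb_inner)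
      (simp add: field_simps power2_eq_square)
qed

text \<open>The derivative of \<open>n2\<close> along \<open>u\<close> is tangent, so only the
  \<open>n1\<close>-part \<open>- s * b\<close> of its derivative along \<open>v\<close>
  contributes. This leaves g b - b', which \<open>b_deriv\<close> evaluates.\<close>

lemma normal_curv_eq:
  assumes p: "p \<in> D"
  shows "normal_curv z n1 n2 p = 2 * mu (fst p) * nu (fst p)"
proof -
  let ?u = "fst p"
  have u: "?u \<in> J" using p by auto
  have n2u: "pu n2 q = comb q 0 (- mu (fst q)) 0 0" if "q \<in> D" for q
    using pu_comb_const[OF frame_eq_comb(4) that] by simp
  have n2v: "pv n2 q = comb q (- s (fst q) * mu (fst q)) 0 (- s (fst q) * b (fst q)) 0"
    if "q \<in> D" for q
    using pv_comb_const[OF frame_eq_comb(4) that refl] by simp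
  have "pu (\<lambda>q. nproj z q (pv n2 q)) p
    = comb p (0 - nu ?u * (- s ?u * b ?u)) (0 - mu ?u * 0)
       (- (- g ?u * s ?u * b ?u + (g ?u * b ?u - 2 * mu ?u * nu ?u) * s ?u) + nu ?u * 0) (0 + mu ?u * 0)"
    by (rule pu_comb[OF _ p, where ?c1.0 = "\<lambda>_. 0" and ?c2.0 = "\<lambda>_. 0"
          and ?c3.0 = "\<lambda>u. - s u * b u" and ?c4.0 = "\<lambda>_. 0"])
      (auto simp: n2v nproj_comb intro!: derivative_eq_intros s_deriv[OF u] b_deriv[OF u])
  moreover have "pv (\<lambda>q. nproj z q (pu n2 q)) p
    = comb p (s ?u * (g ?u * 0 - mu ?u * 0)) (s ?u * (nu ?u * 0 - g ?u * 0))
    (s ?u * (- nu ?u * 0 - b ?u * 0)) (s ?u * (mu ?u * 0 + b ?u * 0))"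
    by (rule pv_comb[OF _ p, where ?c1.0 = "\<lambda>_. 0" and ?c2.0 = "\<lambda>_. 0"
          and ?c3.0 = "\<lambda>_. 0" and ?c4.0 = "\<lambda>_. 0"])
      (auto simp: n2u nproj_comb)
  moreover have "det4 (pu z p) (pv z p) (n1 p) (n2 p) > 0"
  proof -
    have "pu z p = x p" "pv z p = s ?u *\<^sub>R y p"
      using p by (simp_all add: pu_z pv_z comb_def)
    then show ?thesis
      using det_pos[OF p] s_pos[OF u] by (simp add: det4_scale2)
  qed
  ultimately show ?thesis
    using p s_pos[OF u]
    by (simp add: normal_curv_def fEFG nproj_comb comb_diff frame_eq_comb(3) comb_inner)
      (simp add: field_simps)
qed

text \<open>The difference of the squared curvatures is the perfect square of \<mu>^2 -
  \<nu>^2.\<close>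

lemma general_type: "general_type z n1 n2 D"
proof -
  have "(gauss_curv z p)\<^sup>2 - (normal_curv z n1 n2 p)\<^sup>2 > 0 \<and> normal_curv z n1 n2 p \<noteq> 0"
    if p: "p \<in> D" for p
  proof -
    have u: "fst p \<in> J" using p by auto
    have "(gauss_curv z p)\<^sup>2 - (normal_curv z n1 n2 p)\<^sup>2 = ((mu (fst p))\<^sup>2 - (nu (fst p))\<^sup>2)\<^sup>2"
      unfolding gauss_curv_eq[OF p] normal_curv_eq[OF p] by algebra
    then show ?thesis
      using sq_ne[OF u] mu_pos[OF u] nu_nz[OF u] by (simp add: normal_curv_eq[OF p])
  qed
  then show ?thesis by (simp add: general_type_def)
qed

section \<open>The geometric frame\<close>

lemma frx_fry:
  assumes "p \<in> D"
  shows "frx z p = comb p 1 0 0 0" "fry z p = comb p 0 1 0 0"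
  using assms s_pos_D[OF assms]
  by (simp_all add: frx_def fry_def fEFG pu_z pv_z comb_scale real_sqrt_mult)

text \<open>Smoothness enters as a hypothesis because the frame equations of the locale record first
  derivatives only; the constructed surface supplies it separately.\<close>

lemma canonical_surface:
  assumes "smooth2_on D z" "smooth2_on D n1" "smooth2_on D n2"
  shows "canonical_surface z D nu mu"
proof -
  have DxDy: "Dx z f p = pu f p" "Dy z f p = (1 / s (fst p)) *\<^sub>R pv f p" if "p \<in> D" for f p
    using that s_pos_D[OF that] by (simp_all add: Dx_def Dy_def fEFG real_sqrt_mult)
  have derivs: "Dx z (frx z) p = comb p 0 0 (nu u) 0" "Dx z (fry z) p = comb p 0 0 0 (mu u)"
    "Dx z n1 p = comb p (- nu u) 0 0 0" "Dx z n2 p = comb p 0 (- mu u) 0 0"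
    "Dy z (frx z) p = comb p 0 (- g u) 0 (mu u)" "Dy z (fry z) p = comb p (g u) 0 (- nu u) 0"
    "Dy z n1 p = comb p 0 (nu u) 0 (b u)" "Dy z n2 p = comb p (- mu u) 0 (- b u) 0"
    if p: "p \<in> D" and u: "u = fst p" for p u
  proof -
    have "u \<in> J" using p u by auto
    note s = s_pos[OF this]
    note pq = pu_comb_const[OF _ p] pv_comb_const[OF _ p u]
    show "Dx z (frx z) p = comb p 0 0 (nu u) 0" "Dy z (frx z) p = comb p 0 (- g u) 0 (mu u)"
      using s pq[OF frx_fry(1)] by (simp_all add: DxDy p comb_scale u)
    show "Dx z (fry z) p = comb p 0 0 0 (mu u)" "Dy z (fry z) p = comb p (g u) 0 (- nu u) 0"
      using s pq[OF frx_fry(2)] by (simp_all add: DxDy p comb_scale u)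
    show "Dx z n1 p = comb p (- nu u) 0 0 0" "Dy z n1 p = comb p 0 (nu u) 0 (b u)"
      using s pq[OF frame_eq_comb(3)] by (simp_all add: DxDy p comb_scale u)
    show "Dx z n2 p = comb p 0 (- mu u) 0 0" "Dy z n2 p = comb p (- mu u) 0 (- b u) 0"
      using s pq[OF frame_eq_comb(4)] by (simp_all add: DxDy p comb_scale u)
  qed
  have "geometric_frame z D n1 n2 (\<lambda>p. nu (fst p)) (\<lambda>p. mu (fst p)) (\<lambda>p. 0)
    (\<lambda>p. g (fst p)) (\<lambda>p. 0) (\<lambda>p. b (fst p))"
    unfolding geometric_frame_def Let_def
  proof (intro conjI ballI assms)
    fix p assume p: "p \<in> D"
    then have u: "fst p \<in> J" by auto
    show "fF z p = 0" using p by (rule fEFG)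
    show "0 < det4 (frx z p) (fry z p) (n1 p) (n2 p)"
      using det_pos[OF p] by (simp add: frx_fry[OF p] flip: frame_eq_comb)
    show "canonical_dir z p (frx z p)" "canonical_dir z p (fry z p)"
      using p canonical_dirs by (auto simp: frx_fry)
    show "0 < mu (fst p)" "nu (fst p) \<noteq> 0" "(mu (fst p))\<^sup>2 \<noteq> (nu (fst p))\<^sup>2"
      using u mu_pos nu_nz sq_ne by auto
  qed (simp_all add: frx_fry frame_eq_comb derivs[OF _ refl] comb_inner comb_scale comb_add comb_diff)
  then have "\<exists>n1 n2 g2 b1 b2. geometric_frame z D n1 n2 (\<lambda>p. nu (fst p)) (\<lambda>p. mu (fst p))
      (\<lambda>p. 0) g2 b1 b2 \<and> Defs.general_type z n1 n2 D"
    using general_type by blast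
  moreover have "gram z p > 0" if "p \<in> D" for p
    using that s_pos_D[OF that] by (simp add: fEFG)
  ultimately show ?thesis
    using assms minimal s_square
    unfolding canonical_surface_def regular_surface_def
    by (auto simp: fEFG)
qed

end

section \<open>Uniqueness up to rigid motions\<close>

text \<open>Two points of a rectangle are joined by a horizontal and a vertical segment inside
  it.\<close>

lemma eq_of_zero_partials:
  fixes f :: "real \<times> real \<Rightarrow> 'a::real_normed_vector"
  assumes "is_interval A" "is_interval B"
    and fu: "\<And>u v. u \<in> A \<Longrightarrow> v \<in> B \<Longrightarrow> ((\<lambda>t. f (t, v)) has_vector_derivative 0) (at u)"
    and fv: "\<And>u v. u \<in> A \<Longrightarrow> v \<in> B \<Longrightarrow> ((\<lambda>t. f (u, t)) has_vector_derivative 0) (at v)"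
    and "p \<in> A \<times> B" "q \<in> A \<times> B"
  shows "f p = f q"
proof -
  obtain u v u' v' where pq: "p = (u, v)" "q = (u', v')" "u \<in> A" "v \<in> B" "u' \<in> A" "v' \<in> B"
    using assms(5,6) by auto
  have "f (u, v) = f (u', v)"
    using has_vector_derivative_zero_constant[of A "\<lambda>t. f (t, v)"] fu pq assms(1)
    by (metis has_vector_derivative_at_within is_interval_convex)
  also have "\<dots> = f (u', v')"
    using has_vector_derivative_zero_constant[of B "\<lambda>t. f (u', t)"] fv pq assms(2)
    by (metis has_vector_derivative_at_within is_interval_convex)
  finally show ?thesis by (simp add: pq)
qed

text \<open>The frame vectors are the rows. Hence
  \<open>transpose (frame_mat a b c d) ** frame_mat a' b' c' d'\<close> is a sum of outer products,
  and it carries \<open>a'\<close>, \<open>b'\<close>, \<open>c'\<close>, \<open>d'\<close> to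
  \<open>a\<close>, \<open>b\<close>, \<open>c\<close>, \<open>d\<close> when the primed vectors are
  orthonormal.\<close>

definition frame_mat :: "real^4 \<Rightarrow> real^4 \<Rightarrow> real^4 \<Rightarrow> real^4 \<Rightarrow> real^4^4" where
  "frame_mat a b c d = vector [a, b, c, d]"

lemma frame_mat_transition_nth:
  "(transpose (frame_mat a b c d) ** frame_mat a' b' c' d') $ i $ j =
    a $ i * a' $ j + b $ i * b' $ j + c $ i * c' $ j + d $ i * d' $ j"
  by (simp add: matrix_matrix_mult_def sum_4 frame_mat_def vector_4 transpose_def)

lemma frame_mat_transition_mult:
  "(transpose (frame_mat a b c d) ** frame_mat a' b' c' d') *v w =
    (a' \<bullet> w) *\<^sub>R a + (b' \<bullet> w) *\<^sub>R b + (c' \<bullet> w) *\<^sub>R c + (d' \<bullet> w) *\<^sub>R d"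
  by (simp add: vec_eq_iff matrix_vector_mult_def sum_4 frame_mat_transition_nth inner_vec_def
      algebra_simps)

text \<open>The matrix times its transpose is the Gram matrix of the rows, and a one-sided inverse
  of a square matrix is two-sided.\<close>

lemma orthogonal_frame_mat:
  assumes "a \<bullet> a = 1 \<and> b \<bullet> b = 1 \<and> c \<bullet> c = 1 \<and> d \<bullet> d = 1 \<and>
      a \<bullet> b = 0 \<and> a \<bullet> c = 0 \<and> a \<bullet> d = 0 \<and> b \<bullet> c = 0 \<and> b \<bullet> d = 0 \<and> c \<bullet> d = 0"
  shows "orthogonal_matrix (frame_mat a b c d)"
proof -
  have "frame_mat a b c d ** transpose (frame_mat a b c d) = mat 1"
    using assms
    by (simp add: vec_eq_iff forall_4 matrix_matrix_mult_def sum_4 frame_mat_def vector_4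
        transpose_def mat_def inner_vec_def mult.commute)
  then show ?thesis
    by (simp add: orthogonal_matrix matrix_left_right_inverse)
qed

lemma det_frame_mat:
  assumes "orthogonal_matrix (frame_mat a b c d)" "det4 a b c d > 0"
  shows "det (frame_mat a b c d) = 1"
  using det_orthogonal_matrix[OF assms(1)] assms(2) by (auto simp: frame_mat_def det4_def)

text \<open>The transition matrix between the frames is constant and gives the rotation; the
  difference of \<open>z2\<close> and the rotated \<open>z1\<close> is then constant too and gives
  the translation.\<close>

lemma adapted_frames_congruent:
  assumes "adapted_frame J nu mu g b s J1 z1 x1 y1 m1 n1"
    and "adapted_frame J nu mu g b s J2 z2 x2 y2 m2 n2"
    and "J1 \<inter> J2 \<noteq> {}"
  shows "\<exists>(A :: real^4^4) c. orthogonal_matrix A \<and> det A = 1 \<and>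
    (\<forall>p \<in> J \<times> (J1 \<inter> J2). z2 p = A *v z1 p + c)"
proof -
  interpret F1: adapted_frame J nu mu g b s J1 z1 x1 y1 m1 n1 by fact
  interpret F2: adapted_frame J nu mu g b s J2 z2 x2 y2 m2 n2 by fact
  let ?M1 = "\<lambda>p. frame_mat (x1 p) (y1 p) (m1 p) (n1 p)"
  let ?M2 = "\<lambda>p. frame_mat (x2 p) (y2 p) (m2 p) (n2 p)"
  let ?A = "\<lambda>p. transpose (?M2 p) ** ?M1 p"
  let ?D = "J \<times> (J1 \<inter> J2)"
  have ivl: "is_interval J" "is_interval (J1 \<inter> J2)"
    using F1.J F1.J' F2.J' by (auto simp: open_interval_def intro: is_interval_Int)
  obtain p0 where p0: "p0 \<in> ?D"
    using assms(3) F1.J by (auto simp: open_interval_def)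
  have A_const: "?A p = ?A p0" if p: "p \<in> ?D" for p
  proof (subst vec_eq_iff, intro allI, subst vec_eq_iff, intro allI)
    fix i j
    show "?A p $ i $ j = ?A p0 $ i $ j"
    proof (rule eq_of_zero_partials[OF ivl _ _ p p0, of "\<lambda>p. ?A p $ i $ j"])
      fix u v assume uv: "u \<in> J" "v \<in> J1 \<inter> J2"
      then have v: "v \<in> J1" "v \<in> J2" by auto
      note d = F1.x_u[OF uv(1) v(1)] F1.y_u[OF uv(1) v(1)] F1.n1_u[OF uv(1) v(1)] F1.n2_u[OF uv(1) v(1)]
        F1.x_v[OF uv(1) v(1)] F1.y_v[OF uv(1) v(1)] F1.n1_v[OF uv(1) v(1)] F1.n2_v[OF uv(1) v(1)]
        F2.x_u[OF uv(1) v(2)] F2.y_u[OF uv(1) v(2)] F2.n1_u[OF uv(1) v(2)] F2.n2_u[OF uv(1) v(2)]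
        F2.x_v[OF uv(1) v(2)] F2.y_v[OF uv(1) v(2)] F2.n1_v[OF uv(1) v(2)] F2.n2_v[OF uv(1) v(2)]
      note dn = d[THEN has_vector_derivative_vec_nth, folded has_real_derivative_iff_has_vector_derivative]
      show "((\<lambda>t. ?A (t, v) $ i $ j) has_vector_derivative 0) (at u)"
        unfolding frame_mat_transition_nth has_real_derivative_iff_has_vector_derivative[symmetric]
        \<comment> \<open>Both frames have the same skew coefficients, so the terms of the product
          rule cancel in pairs.\<close>
        by (rule derivative_eq_intros dn refl)+ (simp add: algebra_simps)
      show "((\<lambda>t. ?A (u, t) $ i $ j) has_vector_derivative 0) (at v)"
        unfolding frame_mat_transition_nth has_real_derivative_iff_has_vector_derivative[symmetric]
        by (rule derivative_eq_intros dn refl)+ (simp add: algebra_simps)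
    qed
  qed
  define A where "A = ?A p0"
  have orth: "orthogonal_matrix (?M1 p0)" "orthogonal_matrix (?M2 p0)"
    using F1.orthonormal[of p0] F2.orthonormal[of p0] p0 by (auto intro!: orthogonal_frame_mat)
  have det: "det (?M1 p0) = 1" "det (?M2 p0) = 1"
    using F1.det_pos[of p0] F2.det_pos[of p0] p0 by (auto intro!: det_frame_mat[OF orth(1)] det_frame_mat[OF orth(2)])
  have "orthogonal_matrix A"
    using orth by (simp add: A_def orthogonal_matrix_mul)
  moreover have "det A = 1"
    using det by (simp add: A_def det_mul)
  moreover have "z2 p = A *v z1 p + (z2 p0 - A *v z1 p0)" if p: "p \<in> ?D" for p
  proof -
    \<comment> \<open>Constancy allows \<open>A\<close> to be read as the transition matrix at
      \<open>q\<close>, where orthonormality of the first frame evaluates it.\<close>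
    have Axy: "A *v x1 q = x2 q" "A *v y1 q = y2 q" if q: "q \<in> ?D" for q
      using F1.orthonormal[of q] q unfolding A_def A_const[OF q, symmetric]
      by (auto simp: frame_mat_transition_mult inner_commute)
    have "z2 p - A *v z1 p = z2 p0 - A *v z1 p0"
    proof (rule eq_of_zero_partials[OF ivl _ _ p p0, of "\<lambda>p. z2 p - A *v z1 p"])
      fix u v assume uv: "u \<in> J" "v \<in> J1 \<inter> J2"
      then have v: "v \<in> J1" "v \<in> J2" by auto
      note A = bounded_linear.has_vector_derivative[OF matrix_vector_mul_bounded_linear[of A]]
      show "((\<lambda>t. z2 (t, v) - A *v z1 (t, v)) has_vector_derivative 0) (at u)"
        using has_vector_derivative_diff[OF F2.z_u[OF uv(1) v(2)] A[OF F1.z_u[OF uv(1) v(1)]]] Axy uv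
        by simp
      show "((\<lambda>t. z2 (u, t) - A *v z1 (u, t)) has_vector_derivative 0) (at v)"
        using has_vector_derivative_diff[OF F2.z_v[OF uv(1) v(2)] A[OF F1.z_v[OF uv(1) v(1)]]] Axy uv
        by (simp add: matrix_vector_mult_scaleR)
    qed
    then show ?thesis by (simp add: algebra_simps)
  qed
  ultimately show ?thesis by blast
qed

section \<open>From a canonical surface to an adapted frame\<close>

text \<open>The geometric frame leaves \<open>g2\<close>, \<open>b1\<close>, \<open>b2\<close> as
  unknown functions of both parameters. Symmetry of the mixed derivatives of \<open>z\<close> fixes
  \<open>g2\<close>, and then that of \<open>x\<close> fixes \<open>b1\<close> and
  \<open>b2\<close>.\<close>

lemma (in profile) adapted_frame_of_canonical_surface:
  assumes J': "open_interval J'" and surf: "canonical_surface z (J \<times> J') nu mu"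
  shows "\<exists>n1 n2. adapted_frame J nu mu g b s J' z (pu z) (\<lambda>q. (1 / s (fst q)) *\<^sub>R pv z q) n1 n2"
proof -
  let ?D = "J \<times> J'"
  have smooth_z: "smooth2_on ?D z"
    using surf by (simp add: canonical_surface_def regular_surface_def)
  then have D: "open ?D" by (simp add: smooth2_on_def)
  obtain n1 n2 g2 b1 b2 where frame:
    "geometric_frame z ?D n1 n2 (\<lambda>p. nu (fst p)) (\<lambda>p. mu (fst p)) (\<lambda>p. 0) g2 b1 b2"
    using surf by (auto simp: canonical_surface_def)
  define x where "x = pu z"
  define y where "y = (\<lambda>q. (1 / s (fst q)) *\<^sub>R pv z q)"
  have s: "s (fst q) > 0" if "q \<in> ?D" for q
    using that s_pos by auto
  have "fE z q = 1 \<and> fG z q = s (fst q) * s (fst q)" if "q \<in> ?D" for q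
    using surf that s_square by (auto simp: canonical_surface_def)
  then have EG: "sqrt (fE z q) = 1" "sqrt (fG z q) = s (fst q)" if "q \<in> ?D" for q
    using that s[OF that] by (auto simp: real_sqrt_mult)
  have frxy: "frx z q = x q" "fry z q = y q" if "q \<in> ?D" for q
    using EG[OF that] by (simp_all add: frx_def fry_def x_def y_def)
  have Dxy: "Dx z f q = pu f q" "Dy z f q = (1 / s (fst q)) *\<^sub>R pv f q" if "q \<in> ?D" for f q
    using EG[OF that] by (simp_all add: Dx_def Dy_def)
  have frame_q: "x q \<bullet> x q = 1 \<and> y q \<bullet> y q = 1 \<and> n1 q \<bullet> n1 q = 1 \<and> n2 q \<bullet> n2 q = 1 \<and>
      x q \<bullet> y q = 0 \<and> x q \<bullet> n1 q = 0 \<and> x q \<bullet> n2 q = 0 \<and> y q \<bullet> n1 q = 0 \<and> y q \<bullet> n2 q = 0 \<and>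
      n1 q \<bullet> n2 q = 0 \<and> det4 (x q) (y q) (n1 q) (n2 q) > 0 \<and>
      pu x q = nu (fst q) *\<^sub>R n1 q \<and>
      pu y q = mu (fst q) *\<^sub>R n2 q \<and>
      (1 / s (fst q)) *\<^sub>R pv x q = - g2 q *\<^sub>R y q + mu (fst q) *\<^sub>R n2 q \<and>
      (1 / s (fst q)) *\<^sub>R pv y q = g2 q *\<^sub>R x q - nu (fst q) *\<^sub>R n1 q \<and>
      pu n1 q = - nu (fst q) *\<^sub>R x q + b1 q *\<^sub>R n2 q \<and>
      (1 / s (fst q)) *\<^sub>R pv n1 q = nu (fst q) *\<^sub>R y q + b2 q *\<^sub>R n2 q \<and>
      pu n2 q = - mu (fst q) *\<^sub>R y q - b1 q *\<^sub>R n1 q \<and>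
      (1 / s (fst q)) *\<^sub>R pv n2 q = - mu (fst q) *\<^sub>R x q - b2 q *\<^sub>R n1 q"
    if q: "q \<in> ?D" for q
  proof -
    \<comment> \<open>The normalised fields agree with \<open>x\<close> and \<open>y\<close> only on
      the open set \<open>D\<close>, which is enough for their derivatives there.\<close>
    have "pu (frx z) q = pu x q" "pv (frx z) q = pv x q" "pu (fry z) q = pu y q" "pv (fry z) q = pv y q"
      using frxy by (auto intro: pu_cong[OF D q] pv_cong[OF D q])
    then show ?thesis
      using frame[unfolded geometric_frame_def Let_def, THEN conjunct2, THEN conjunct2, rule_format, OF q]
      by (simp add: frxy[OF q] Dxy[OF q])
  qed
  have unscale: "w = s (fst q) *\<^sub>R w'" if "(1 / s (fst q)) *\<^sub>R w = w'" "q \<in> ?D"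
    for q and w w' :: "real^4"
    using that s[OF that(2)] by auto
  have pvs: "pv x q = s (fst q) *\<^sub>R (- g2 q *\<^sub>R y q + mu (fst q) *\<^sub>R n2 q)"
    "pv y q = s (fst q) *\<^sub>R (g2 q *\<^sub>R x q - nu (fst q) *\<^sub>R n1 q)"
    "pv n1 q = s (fst q) *\<^sub>R (nu (fst q) *\<^sub>R y q + b2 q *\<^sub>R n2 q)"
    "pv n2 q = s (fst q) *\<^sub>R (- mu (fst q) *\<^sub>R x q - b2 q *\<^sub>R n1 q)" if "q \<in> ?D" for q
    using frame_q[OF that] that by (blast intro: unscale)+
  have smooth_n: "smooth2_on ?D n1" "smooth2_on ?D n2"
    using frame by (simp_all add: geometric_frame_def)
  have diff_x: "x differentiable (at q)" if "q \<in> ?D" for q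
    using smooth2_onD(2)[OF smooth_z that] by (simp add: x_def)
  have diff_y: "y differentiable (at q)" if "q \<in> ?D" for q
  proof -
    have "(\<lambda>q. s (fst q)) differentiable (at q)"
      by (rule differentiable_comp_fst[OF s_deriv]) (use that in auto)
    then show ?thesis
      unfolding y_def using smooth2_onD(3)[OF smooth_z that] s[OF that]
      by (intro differentiable_scaleR differentiable_divide) auto
  qed
  have diff_n: "n1 differentiable (at q)" "n2 differentiable (at q)" if "q \<in> ?D" for q
    using smooth2_onD(1)[OF smooth_n(1) that] smooth2_onD(1)[OF smooth_n(2) that] .
  have pu_combn: "pu f (u, v) = c' *\<^sub>R y (u, v) + c u *\<^sub>R pu y (u, v) + e' *\<^sub>R n2 (u, v) + e u *\<^sub>R pu n2 (u, v)"
    if "u \<in> J" "v \<in> J'" "\<And>q. q \<in> ?D \<Longrightarrow> f q = c (fst q) *\<^sub>R y q + e (fst q) *\<^sub>R n2 q"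
      "(c has_real_derivative c') (at u)" "(e has_real_derivative e') (at u)"
    for f c c' e e' u v
  proof -
    have "pu f (u, v) = pu (\<lambda>q. c (fst q) *\<^sub>R y q + e (fst q) *\<^sub>R n2 q) (u, v)"
      using that by (intro pu_cong[OF D]) auto
    also have "\<dots> = c' *\<^sub>R y (u, v) + c u *\<^sub>R pu y (u, v) + e' *\<^sub>R n2 (u, v) + e u *\<^sub>R pu n2 (u, v)"
      using that has_pu[OF diff_y, of u v] has_pu[OF diff_n(2), of u v]
      by (intro pu_eqI) (auto intro!: derivative_eq_intros)
    finally show ?thesis .
  qed
  \<comment> \<open>The \<open>y\<close>-components of the two mixed derivatives of \<open>z\<close>
    are compared: one comes from the derivative of \<open>s\<close>, the other from the frame
    equation for \<open>x\<close> along \<open>v\<close>.\<close>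
  have g2: "g2 q = g (fst q)" if q: "q \<in> ?D" for q
  proof -
    obtain u v where uv: "q = (u, v)" "u \<in> J" "v \<in> J'" using q by auto
    have "pu (pv z) q = (- g u * s u) *\<^sub>R y q + s u *\<^sub>R pu y q"
      using pu_combn[OF uv(2,3), of "pv z" s "\<lambda>_. 0" "- g u * s u" 0] s_deriv[OF uv(2)] s uv
      by (simp add: y_def less_imp_neq[symmetric])
    then have "(- g u * s u) *\<^sub>R y q + s u *\<^sub>R (mu u *\<^sub>R n2 q)
        = s u *\<^sub>R (- g2 q *\<^sub>R y q + mu u *\<^sub>R n2 q)"
      using pv_pu_eq_pu_pv[OF smooth_z q] pvs(1)[OF q] frame_q[OF q] by (simp add: uv(1) x_def)
    then have "((- g u * s u) *\<^sub>R y q + s u *\<^sub>R (mu u *\<^sub>R n2 q)) \<bullet> y q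
        = (s u *\<^sub>R (- g2 q *\<^sub>R y q + mu u *\<^sub>R n2 q)) \<bullet> y q"
      by simp
    then show ?thesis
      using s[OF q] frame_q[OF q] by (simp add: inner_add_left inner_diff_left uv(1) inner_commute[of "n2 (u, v)" "y (u, v)"])
  qed
  \<comment> \<open>Knowing \<open>g2\<close>, the coefficients of \<open>pv x\<close> depend on
    \<open>u\<close> alone and can be differentiated. The \<open>n1\<close>-component of the
    symmetry for \<open>x\<close> reads \<open>s u * mu u * b1 q = 0\<close>; the
    \<open>n2\<close>-component determines \<open>b2\<close> because \<open>nu\<close> does not
    vanish.\<close>
  have b: "b1 q = 0" "b2 q = b (fst q)" if q: "q \<in> ?D" for q
  proof -
    obtain u v where uv: "q = (u, v)" "u \<in> J" "v \<in> J'" using q by auto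
    have "((\<lambda>t. - (s t * g t)) has_real_derivative
        - (- g u * s u * g u + ((g u)\<^sup>2 - (mu u)\<^sup>2 - (nu u)\<^sup>2) * s u)) (at u)"
      by (auto intro!: derivative_eq_intros s_deriv g_deriv uv)
    moreover have "((\<lambda>t. s t * mu t) has_real_derivative
        - g u * s u * mu u + (2 * g u * mu u + b u * nu u) * s u) (at u)"
      by (auto intro!: derivative_eq_intros s_deriv mu_deriv uv)
    ultimately have "pu (pv x) q = - (- g u * s u * g u + ((g u)\<^sup>2 - (mu u)\<^sup>2 - (nu u)\<^sup>2) * s u) *\<^sub>R y q
        + (- (s u * g u)) *\<^sub>R pu y q + (- g u * s u * mu u + (2 * g u * mu u + b u * nu u) * s u) *\<^sub>R n2 q
        + (s u * mu u) *\<^sub>R pu n2 q"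
      unfolding uv(1) by (intro pu_combn[OF uv(2,3)]) (simp_all add: pvs(1) g2 algebra_simps)
    moreover have "pv (pu x) q = nu u *\<^sub>R pv n1 q"
    proof -
      have "pv (pu x) q = pv (\<lambda>q. nu (fst q) *\<^sub>R n1 q) q"
        using frame_q by (intro pv_cong[OF D q]) blast
      also have "\<dots> = nu u *\<^sub>R pv n1 q"
        unfolding uv(1) using has_pv[OF diff_n(1)] uv
        by (intro pv_eqI) (auto intro!: derivative_eq_intros)
      finally show ?thesis .
    qed
    ultimately have eq: "nu u *\<^sub>R pv n1 q
      = - (- g u * s u * g u + ((g u)\<^sup>2 - (mu u)\<^sup>2 - (nu u)\<^sup>2) * s u) *\<^sub>R y q
        + (- (s u * g u)) *\<^sub>R pu y q + (- g u * s u * mu u + (2 * g u * mu u + b u * nu u) * s u) *\<^sub>R n2 q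
        + (s u * mu u) *\<^sub>R pu n2 q"
      using pv_pu_eq_pu_pv[OF smooth2_on_pu[OF smooth_z] q] by (simp add: x_def)
    have uq: "fst q = u" by (simp add: uv(1))
    note fq = frame_q[OF q, unfolded uq]
    have "s u * mu u * b1 q = 0"
      using arg_cong[OF eq, of "\<lambda>w. w \<bullet> n1 q"] pvs(3)[OF q, unfolded uq] fq
      by (simp add: inner_add_left inner_diff_left inner_commute[of "n2 q" "n1 q"])
    then show "b1 q = 0"
      using s_pos[OF uv(2)] mu_pos[OF uv(2)] by simp
    have "nu u * s u * b2 q = nu u * s u * b u"
      using arg_cong[OF eq, of "\<lambda>w. w \<bullet> n2 q"] pvs(3)[OF q, unfolded uq] fq
      by (simp add: inner_add_left inner_diff_left algebra_simps)
    then show "b2 q = b (fst q)"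
      using s_pos[OF uv(2)] nu_nz[OF uv(2)] by (simp add: uq)
  qed
  have "adapted_frame J nu mu g b s J' z x y n1 n2"
  proof (intro adapted_frame.intro adapted_frame_axioms.intro J' profile_axioms)
    fix u v assume uv: "u \<in> J" "v \<in> J'"
    then have q: "(u, v) \<in> ?D" by simp
    note fq = frame_q[OF q]
    show "((\<lambda>t. z (t, v)) has_vector_derivative x (u, v)) (at u)"
      using has_pu[OF smooth2_onD(1)[OF smooth_z q]] by (simp add: x_def)
    show "((\<lambda>t. z (u, t)) has_vector_derivative s u *\<^sub>R y (u, v)) (at v)"
      using has_pv[OF smooth2_onD(1)[OF smooth_z q]] s[OF q] by (simp add: y_def)
    show "((\<lambda>t. x (t, v)) has_vector_derivative nu u *\<^sub>R n1 (u, v)) (at u)"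
      "((\<lambda>t. y (t, v)) has_vector_derivative mu u *\<^sub>R n2 (u, v)) (at u)"
      "((\<lambda>t. n1 (t, v)) has_vector_derivative - nu u *\<^sub>R x (u, v)) (at u)"
      "((\<lambda>t. n2 (t, v)) has_vector_derivative - mu u *\<^sub>R y (u, v)) (at u)"
      using has_pu[OF diff_x[OF q]] has_pu[OF diff_y[OF q]] has_pu[OF diff_n(1)[OF q]]
        has_pu[OF diff_n(2)[OF q]] fq b[OF q] by simp_all
    show "((\<lambda>t. x (u, t)) has_vector_derivative
        s u *\<^sub>R (- g u *\<^sub>R y (u, v) + mu u *\<^sub>R n2 (u, v))) (at v)"
      "((\<lambda>t. y (u, t)) has_vector_derivative
        s u *\<^sub>R (g u *\<^sub>R x (u, v) - nu u *\<^sub>R n1 (u, v))) (at v)"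
      "((\<lambda>t. n1 (u, t)) has_vector_derivative
        s u *\<^sub>R (nu u *\<^sub>R y (u, v) + b u *\<^sub>R n2 (u, v))) (at v)"
      "((\<lambda>t. n2 (u, t)) has_vector_derivative
        s u *\<^sub>R (- mu u *\<^sub>R x (u, v) - b u *\<^sub>R n1 (u, v))) (at v)"
      using has_pv[OF diff_x[OF q]] has_pv[OF diff_y[OF q]] has_pv[OF diff_n(1)[OF q]]
        has_pv[OF diff_n(2)[OF q]] pvs[OF q] b[OF q] g2[OF q] by simp_all
  qed (use frame_q in blast)+
  then show ?thesis unfolding x_def y_def by blast
qed

section \<open>Existence\<close>

text \<open>The integral from a fixed base point serves on all of \<open>J\<close>: for each
  \<open>u\<close> the fundamental theorem is applied on a compact interval in \<open>J\<close>
  having both points in its interior.\<close>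

lemma interval_antiderivative:
  fixes q :: "real \<Rightarrow> real"
  assumes J: "open_interval J" and q: "\<And>u. u \<in> J \<Longrightarrow> isCont q u"
  obtains Q where "\<And>u. u \<in> J \<Longrightarrow> (Q has_real_derivative q u) (at u)"
proof -
  obtain u0 where u0: "u0 \<in> J"
    using J by (auto simp: open_interval_def)
  have "((\<lambda>x. LBINT t=u0..x. q t) has_vector_derivative q u) (at u)" if u: "u \<in> J" for u
  proof -
    have "\<exists>e>0. \<forall>t. dist t w < e \<longrightarrow> t \<in> J" if "w \<in> J" for w
      using J that by (auto simp: open_interval_def open_dist)
    then obtain d e where e: "d > 0" "\<And>t. dist t (min u u0) < d \<Longrightarrow> t \<in> J"
      "e > 0" "\<And>t. dist t (max u u0) < e \<Longrightarrow> t \<in> J"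
      using u u0 by (metis max_def min_def)
    define a c where "a = min u u0 - d / 2" and "c = max u u0 + e / 2"
    have ac: "a \<in> J" "c \<in> J" "a < u" "a < u0" "u < c" "u0 < c"
      using e by (auto simp: a_def c_def dist_real_def)
    have sub: "{a..c} \<subseteq> J"
      using J ac(1,2) by (auto simp: open_interval_def intro: mem_is_interval_1_I)
    have "((\<lambda>x. LBINT t=u0..x. q t) has_vector_derivative q u) (at u within {a..c})"
      using ac sub q
      by (intro interval_integral_FTC2 continuous_at_imp_continuous_on) auto
    then show ?thesis
      using ac by (simp add: at_within_Icc_at)
  qed
  then show thesis
    by (intro that[of "\<lambda>x. LBINT t=u0..x. q t"])
      (simp add: has_real_derivative_iff_has_vector_derivative)
qed

text \<open>The vector \<open>(P, M)\<close> turns with angular speed \<open>w\<close> and keeps its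
  length. Since \<open>M\<close> never vanishes, the polar angle has one formula on all of
  \<open>J\<close>; the constant \<open>c\<close> carries the sign of \<open>M\<close>.\<close>

lemma rotating_pair_polar:
  fixes P M w :: "real \<Rightarrow> real"
  assumes J: "is_interval J"
    and P: "\<And>u. u \<in> J \<Longrightarrow> (P has_real_derivative - M u * w u) (at u)"
    and M: "\<And>u. u \<in> J \<Longrightarrow> (M has_real_derivative P u * w u) (at u)"
    and nz: "\<And>u. u \<in> J \<Longrightarrow> M u \<noteq> 0"
  obtains c \<theta> where "\<And>u. u \<in> J \<Longrightarrow> (\<theta> has_real_derivative w u) (at u)"
    "\<And>u. u \<in> J \<Longrightarrow> P u = c * cos (\<theta> u)" "\<And>u. u \<in> J \<Longrightarrow> M u = c * sin (\<theta> u)"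
proof -
  \<comment> \<open>This is the inverse cotangent of \<open>P / M\<close>, with values strictly
    between 0 and \<pi>.\<close>
  define \<theta> where "\<theta> u = pi / 2 - arctan (P u / M u)" for u
  have \<theta>: "(\<theta> has_real_derivative w u) (at u)" if u: "u \<in> J" for u
  proof -
    have "(M u)\<^sup>2 + (P u)\<^sup>2 \<noteq> 0" "1 + (P u / M u)\<^sup>2 \<noteq> 0"
      using nz[OF u] by (simp_all add: add_nonneg_eq_0_iff)
    then show ?thesis
      unfolding \<theta>_def[abs_def]
      using nz[OF u]
      by (auto intro!: derivative_eq_intros P M u simp: divide_simps)
        (simp_all add: algebra_simps power2_eq_square)
  qed
  have perp: "P u * sin (\<theta> u) = M u * cos (\<theta> u)" if "u \<in> J" for u
    using nz[OF that]
    by (simp add: \<theta>_def cos_diff sin_diff sin_arctan cos_arctan)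
  \<comment> \<open>The signed length of \<open>(P, M)\<close> along its own direction has zero
    derivative; its value is \<open>c\<close>.\<close>
  have "((\<lambda>u. P u * cos (\<theta> u) + M u * sin (\<theta> u)) has_vector_derivative 0) (at u within J)"
    if "u \<in> J" for u
    unfolding has_real_derivative_iff_has_vector_derivative[symmetric]
    by (rule has_field_derivative_at_within)
      (auto intro!: derivative_eq_intros P M \<theta> that simp: algebra_simps)
  then obtain c where c: "\<And>u. u \<in> J \<Longrightarrow> P u * cos (\<theta> u) + M u * sin (\<theta> u) = c"
    using has_vector_derivative_zero_constant[of J "\<lambda>u. P u * cos (\<theta> u) + M u * sin (\<theta> u)"]
      is_interval_convex[OF J] by blast
  have "P u = c * cos (\<theta> u)" "M u = c * sin (\<theta> u)" if "u \<in> J" for u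
  proof -
    have "c * cos (\<theta> u) = P u * ((sin (\<theta> u))\<^sup>2 + (cos (\<theta> u))\<^sup>2)"
      "c * sin (\<theta> u) = M u * ((sin (\<theta> u))\<^sup>2 + (cos (\<theta> u))\<^sup>2)"
      unfolding c[OF that, symmetric] using perp[OF that] by algebra+
    then show "P u = c * cos (\<theta> u)" "M u = c * sin (\<theta> u)"
      by simp_all
  qed
  with \<theta> show thesis by (rule that)
qed

text \<open>For \<open>k = 0\<close> the rotation with speed \<open>k\<close> degenerates to a translation, so the block is not
  a rotating curve \<open>h / k\<close>.\<close>

lemma planar_block:
  fixes h q :: "real \<Rightarrow> real"
  assumes J: "open_interval J"
    and h: "\<And>u. u \<in> J \<Longrightarrow> (h has_real_derivative k * q u) (at u)"
    and q: "\<And>u. u \<in> J \<Longrightarrow> isCont q u"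
  obtains z1 z2 :: "real \<times> real \<Rightarrow> real" where
    "\<And>p. p \<in> J \<times> UNIV \<Longrightarrow> z1 differentiable (at p)"
    "\<And>p. p \<in> J \<times> UNIV \<Longrightarrow> z2 differentiable (at p)"
    "\<And>u v. u \<in> J \<Longrightarrow> ((\<lambda>t. z1 (t, v)) has_real_derivative q u * cos (k * v)) (at u)"
    "\<And>u v. u \<in> J \<Longrightarrow> ((\<lambda>t. z2 (t, v)) has_real_derivative q u * sin (k * v)) (at u)"
    "\<And>u v. u \<in> J \<Longrightarrow> ((\<lambda>t. z1 (u, t)) has_real_derivative - h u * sin (k * v)) (at v)"
    "\<And>u v. u \<in> J \<Longrightarrow> ((\<lambda>t. z2 (u, t)) has_real_derivative h u * cos (k * v)) (at v)"
proof -
  have fst_diff: "(\<lambda>p. f (fst p)) differentiable (at p)"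
    if "\<And>u. u \<in> J \<Longrightarrow> (f has_real_derivative f' u) (at u)" "p \<in> J \<times> UNIV"
    for f f' and p :: "real \<times> real"
    by (rule differentiable_comp_fst[OF that(1)]) (use that(2) in auto)
  \<comment> \<open>The hypothesis on \<open>h\<close> is the integrability condition of the four
    prescribed partial derivatives.\<close>
  show thesis
  proof (cases "k = 0")
    case True
    \<comment> \<open>For zero speed \<open>h\<close> is constant, and the block is a primitive of
      \<open>q\<close> in one coordinate and \<open>h\<close> times \<open>v\<close> in the
      other.\<close>
    obtain Q where Q: "\<And>u. u \<in> J \<Longrightarrow> (Q has_real_derivative q u) (at u)"
      using interval_antiderivative[OF J q] by blast
    show thesis
    proof (rule that[of "\<lambda>p. Q (fst p)" "\<lambda>p. h (fst p) * snd p"])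
      show "(\<lambda>p. Q (fst p)) differentiable (at p)" if "p \<in> J \<times> UNIV" for p :: "real \<times> real"
        by (rule fst_diff[OF Q that])
      show "(\<lambda>p. h (fst p) * snd p) differentiable (at p)" if "p \<in> J \<times> UNIV" for p :: "real \<times> real"
        by (intro differentiable_mult fst_diff[OF h that] differentiable_comp_snd[where f = "\<lambda>t. t" and d = 1])
          (auto intro!: derivative_eq_intros)
    qed (use True h in \<open>auto intro!: derivative_eq_intros Q\<close>)
  next
    case False
    \<comment> \<open>Here the point at signed radius \<open>h / k\<close> is turned by the angle
      \<open>k * v\<close>; the derivative of the radius is \<open>q\<close>.\<close>
    show thesis
    proof (rule that[of "\<lambda>p. h (fst p) * (cos (k * snd p) / k)" "\<lambda>p. h (fst p) * (sin (k * snd p) / k)"])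
      show "(\<lambda>p. h (fst p) * (cos (k * snd p) / k)) differentiable (at p)"
        if "p \<in> J \<times> UNIV" for p :: "real \<times> real"
        by (intro differentiable_mult fst_diff[OF h that]
            differentiable_comp_snd[where f = "\<lambda>t. cos (k * t) / k" and d = "- sin (k * snd p)"])
          (use False in \<open>auto intro!: derivative_eq_intros\<close>)
      show "(\<lambda>p. h (fst p) * (sin (k * snd p) / k)) differentiable (at p)"
        if "p \<in> J \<times> UNIV" for p :: "real \<times> real"
        by (intro differentiable_mult fst_diff[OF h that]
            differentiable_comp_snd[where f = "\<lambda>t. sin (k * t) / k" and d = "cos (k * snd p)"])
          (use False in \<open>auto intro!: derivative_eq_intros\<close>)
    qed (use False h in \<open>auto intro!: derivative_eq_intros\<close>)
  qed
qed

section \<open>The explicit frame and the surface it bounds to\<close>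

lemma has_vector_derivative_vector4:
  assumes "(f1 has_real_derivative d1) (at a)" "(f2 has_real_derivative d2) (at a)"
    "(f3 has_real_derivative d3) (at a)" "(f4 has_real_derivative d4) (at a)"
    "d = vector [d1, d2, d3, d4]"
  shows "((\<lambda>t. vector [f1 t, f2 t, f3 t, f4 t] :: real^4) has_vector_derivative d) (at a)"
proof (rule has_vector_derivative_vecI)
  have "\<forall>i. ((\<lambda>t. (vector [f1 t, f2 t, f3 t, f4 t] :: real^4) $ i) has_vector_derivative d $ i) (at a)"
    using assms by (simp add: forall_4 vector_4 has_real_derivative_iff_has_vector_derivative)
  then show "((\<lambda>t. (vector [f1 t, f2 t, f3 t, f4 t] :: real^4) $ i) has_vector_derivative d $ i) (at a)"
    for i by blast
qed

text \<open>Let r, t be the radial and tangential unit vectors at angle \<open>\<alpha> * v\<close>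
  in the first coordinate plane, and r', t' those at angle \<open>\<beta> * v\<close> in the second.
  Then \<open>(x, m)\<close> is \<open>(r, r')\<close> rotated by \<phi>, and \<open>(y, n)\<close>
  is \<open>(t, t')\<close> rotated by \<psi>. The variables \<open>c1\<close> to \<open>s4\<close>
  stand for the cosines and sines of \<phi>, \<psi> and these two angles.\<close>

lemma double_rotation_frame:
  fixes c1 s1 c2 s2 c3 s3 c4 s4 :: real
  defines "x \<equiv> vector [c1 * c3, c1 * s3, s1 * c4, s1 * s4] :: real^4"
    and "y \<equiv> vector [- c2 * s3, c2 * c3, - s2 * s4, s2 * c4] :: real^4"
    and "m \<equiv> vector [- s1 * c3, - s1 * s3, c1 * c4, c1 * s4] :: real^4"
    and "n \<equiv> vector [s2 * s3, - s2 * c3, - c2 * s4, c2 * c4] :: real^4"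
  assumes unit: "c1\<^sup>2 + s1\<^sup>2 = 1" "c2\<^sup>2 + s2\<^sup>2 = 1" "c3\<^sup>2 + s3\<^sup>2 = 1" "c4\<^sup>2 + s4\<^sup>2 = 1"
  shows "x \<bullet> x = 1" "y \<bullet> y = 1" "m \<bullet> m = 1" "n \<bullet> n = 1" "x \<bullet> y = 0" "x \<bullet> m = 0" "x \<bullet> n = 0"
    "y \<bullet> m = 0" "y \<bullet> n = 0" "m \<bullet> n = 0" "det4 x y m n = 1"
proof -
  note d = x_def y_def m_def n_def inner_vec_def sum_4 vector_4
  have "x \<bullet> x = c1\<^sup>2 * (c3\<^sup>2 + s3\<^sup>2) + s1\<^sup>2 * (c4\<^sup>2 + s4\<^sup>2)"
    "y \<bullet> y = c2\<^sup>2 * (c3\<^sup>2 + s3\<^sup>2) + s2\<^sup>2 * (c4\<^sup>2 + s4\<^sup>2)"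
    "m \<bullet> m = s1\<^sup>2 * (c3\<^sup>2 + s3\<^sup>2) + c1\<^sup>2 * (c4\<^sup>2 + s4\<^sup>2)"
    "n \<bullet> n = s2\<^sup>2 * (c3\<^sup>2 + s3\<^sup>2) + c2\<^sup>2 * (c4\<^sup>2 + s4\<^sup>2)"
    "x \<bullet> m = - c1 * s1 * (c3\<^sup>2 + s3\<^sup>2) + c1 * s1 * (c4\<^sup>2 + s4\<^sup>2)"
    "y \<bullet> n = - c2 * s2 * (c3\<^sup>2 + s3\<^sup>2) + c2 * s2 * (c4\<^sup>2 + s4\<^sup>2)"
    by (simp_all add: d power2_eq_square algebra_simps)
  then show "x \<bullet> x = 1" "y \<bullet> y = 1" "m \<bullet> m = 1" "n \<bullet> n = 1" "x \<bullet> m = 0" "y \<bullet> n = 0"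
    using unit by (simp_all add: add.commute)
  show "x \<bullet> y = 0" "x \<bullet> n = 0" "y \<bullet> m = 0" "m \<bullet> n = 0"
    by (simp_all add: d algebra_simps)
  have "det4 x y m n = (c1\<^sup>2 + s1\<^sup>2) * (c2\<^sup>2 + s2\<^sup>2) * (c3\<^sup>2 + s3\<^sup>2) * (c4\<^sup>2 + s4\<^sup>2)"
    unfolding det4_def det_4 x_def y_def m_def n_def vector_4 by algebra
  then show "det4 x y m n = 1"
    using unit by simp
qed

text \<open>Along \<open>v\<close> the frame performs rotations of constant speed, which are defined
  for all \<open>v\<close>, so the second parameter ranges over the whole line.\<close>

lemma (in profile) exists_canonical_surface: "\<exists>z. canonical_surface z (J \<times> UNIV) nu mu"
proof -
  have ivl: "is_interval J" and open_J: "open J"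
    using J by (auto simp: open_interval_def)
  have mp: "mu u - nu u \<noteq> 0" "mu u + nu u \<noteq> 0" if "u \<in> J" for u
    using sq_ne[OF that] by (auto simp: power2_eq_square eq_neg_iff_add_eq_0[symmetric])
  obtain k1 t1 where t1: "\<And>u. u \<in> J \<Longrightarrow> (t1 has_real_derivative mu u - nu u) (at u)"
    "\<And>u. u \<in> J \<Longrightarrow> s u * (g u - b u) = k1 * cos (t1 u)"
    "\<And>u. u \<in> J \<Longrightarrow> s u * (mu u - nu u) = k1 * sin (t1 u)"
  proof (rule rotating_pair_polar[OF ivl, of "\<lambda>u. s u * (g u - b u)" "\<lambda>u. s u * (mu u - nu u)"
        "\<lambda>u. mu u - nu u"])
    show "((\<lambda>u. s u * (g u - b u)) has_real_derivative - (s u * (mu u - nu u)) * (mu u - nu u)) (at u)"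
      "((\<lambda>u. s u * (mu u - nu u)) has_real_derivative s u * (g u - b u) * (mu u - nu u)) (at u)"
      if "u \<in> J" for u
      by (auto intro!: derivative_eq_intros s_deriv g_deriv b_deriv mu_deriv nu_deriv that
          simp: algebra_simps power2_eq_square)
  qed (use mp s_pos in \<open>force+\<close>)
  obtain k2 t2 where t2: "\<And>u. u \<in> J \<Longrightarrow> (t2 has_real_derivative mu u + nu u) (at u)"
    "\<And>u. u \<in> J \<Longrightarrow> s u * (g u + b u) = k2 * cos (t2 u)"
    "\<And>u. u \<in> J \<Longrightarrow> s u * (mu u + nu u) = k2 * sin (t2 u)"
  proof (rule rotating_pair_polar[OF ivl, of "\<lambda>u. s u * (g u + b u)" "\<lambda>u. s u * (mu u + nu u)"
        "\<lambda>u. mu u + nu u"])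
    show "((\<lambda>u. s u * (g u + b u)) has_real_derivative - (s u * (mu u + nu u)) * (mu u + nu u)) (at u)"
      "((\<lambda>u. s u * (mu u + nu u)) has_real_derivative s u * (g u + b u) * (mu u + nu u)) (at u)"
      if "u \<in> J" for u
      by (auto intro!: derivative_eq_intros s_deriv g_deriv b_deriv mu_deriv nu_deriv that
          simp: algebra_simps power2_eq_square)
  qed (use mp s_pos in \<open>force+\<close>)
  \<comment> \<open>The polar angles are \<psi> - \<phi> and \<psi> + \<phi>, so the derivatives of
    \<phi> and \<psi> are \<open>nu\<close> and \<open>mu\<close>.\<close>
  define \<phi> \<psi> where "\<phi> u = (t2 u - t1 u) / 2" and "\<psi> u = (t1 u + t2 u) / 2" for u
  \<comment> \<open>Thus \<open>k1 = - \<alpha> - \<beta>\<close> and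
    \<open>k2 = \<beta> - \<alpha>\<close>, and the sums and differences of the polar formulas
    separate into products.\<close>
  define \<alpha> \<beta> where "\<alpha> = - (k1 + k2) / 2" and "\<beta> = (k2 - k1) / 2"
  have ang: "(\<phi> has_real_derivative nu u) (at u)" "(\<psi> has_real_derivative mu u) (at u)"
    if "u \<in> J" for u
    unfolding \<phi>_def[abs_def] \<psi>_def[abs_def] by (auto intro!: derivative_eq_intros t1 t2 that)
  have K0: "s u * g u = - \<alpha> * cos (\<phi> u) * cos (\<psi> u) - \<beta> * sin (\<phi> u) * sin (\<psi> u)"
    "s u * mu u = - \<alpha> * cos (\<phi> u) * sin (\<psi> u) + \<beta> * sin (\<phi> u) * cos (\<psi> u)"
    "s u * nu u = - \<alpha> * sin (\<phi> u) * cos (\<psi> u) + \<beta> * cos (\<phi> u) * sin (\<psi> u)"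
    "s u * b u = \<alpha> * sin (\<phi> u) * sin (\<psi> u) + \<beta> * cos (\<phi> u) * cos (\<psi> u)" if "u \<in> J" for u
  proof -
    have "t1 u = \<psi> u - \<phi> u" "t2 u = \<psi> u + \<phi> u"
      by (simp_all add: \<phi>_def \<psi>_def field_simps)
    then have "s u * (g u - b u) = k1 * (cos (\<psi> u) * cos (\<phi> u) + sin (\<psi> u) * sin (\<phi> u))"
      "s u * (mu u - nu u) = k1 * (sin (\<psi> u) * cos (\<phi> u) - cos (\<psi> u) * sin (\<phi> u))"
      "s u * (g u + b u) = k2 * (cos (\<psi> u) * cos (\<phi> u) - sin (\<psi> u) * sin (\<phi> u))"
      "s u * (mu u + nu u) = k2 * (sin (\<psi> u) * cos (\<phi> u) + cos (\<psi> u) * sin (\<phi> u))"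
      using t1(2,3)[OF that] t2(2,3)[OF that] by (simp_all add: cos_diff cos_add sin_diff sin_add)
    moreover have "2 * \<alpha> = - k1 - k2" "2 * \<beta> = k2 - k1" by (simp_all add: \<alpha>_def \<beta>_def)
    ultimately show "s u * g u = - \<alpha> * cos (\<phi> u) * cos (\<psi> u) - \<beta> * sin (\<phi> u) * sin (\<psi> u)"
    "s u * mu u = - \<alpha> * cos (\<phi> u) * sin (\<psi> u) + \<beta> * sin (\<phi> u) * cos (\<psi> u)"
    "s u * nu u = - \<alpha> * sin (\<phi> u) * cos (\<psi> u) + \<beta> * cos (\<phi> u) * sin (\<psi> u)"
    "s u * b u = \<alpha> * sin (\<phi> u) * sin (\<psi> u) + \<beta> * cos (\<phi> u) * cos (\<psi> u)"
      by algebra+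
  qed
  \<comment> \<open>Rotating the coefficients back by \<phi> or \<psi> gives the frame equations
    along \<open>v\<close> in the two fixed planes: the components in the first involve only
    \<alpha>, those in the second only \<beta>.\<close>
  have K: "\<alpha> * cos (\<phi> u) = - (s u * g u) * cos (\<psi> u) - s u * mu u * sin (\<psi> u)"
    "\<beta> * sin (\<phi> u) = - (s u * g u) * sin (\<psi> u) + s u * mu u * cos (\<psi> u)"
    "\<alpha> * cos (\<psi> u) = - (s u * g u) * cos (\<phi> u) - s u * nu u * sin (\<phi> u)"
    "\<beta> * sin (\<psi> u) = - (s u * g u) * sin (\<phi> u) + s u * nu u * cos (\<phi> u)"
    "\<alpha> * sin (\<phi> u) = s u * b u * sin (\<psi> u) - s u * nu u * cos (\<psi> u)"
    "\<beta> * cos (\<phi> u) = s u * b u * cos (\<psi> u) + s u * nu u * sin (\<psi> u)"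
    "\<alpha> * sin (\<psi> u) = s u * b u * sin (\<phi> u) - s u * mu u * cos (\<phi> u)"
    "\<beta> * cos (\<psi> u) = s u * b u * cos (\<phi> u) + s u * mu u * sin (\<phi> u)" if "u \<in> J" for u
    unfolding K0[OF that]
    using sin_cos_squared_add[of "\<phi> u"] sin_cos_squared_add[of "\<psi> u"] by algebra+
  \<comment> \<open>This and the next fact are the integrability conditions of \<open>z\<close> in
    the first and the second plane.\<close>
  have h1: "((\<lambda>u. s u * cos (\<psi> u)) has_real_derivative \<alpha> * cos (\<phi> u)) (at u)" if "u \<in> J" for u
    by (auto intro!: derivative_eq_intros s_deriv ang that simp: K[OF that])
  have h2: "((\<lambda>u. s u * sin (\<psi> u)) has_real_derivative \<beta> * sin (\<phi> u)) (at u)" if "u \<in> J" for u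
    by (auto intro!: derivative_eq_intros s_deriv ang that simp: K[OF that])
  have cont: "isCont (\<lambda>u. cos (\<phi> u)) u" "isCont (\<lambda>u. sin (\<phi> u)) u" if "u \<in> J" for u
    using DERIV_isCont[OF ang(1)[OF that]] by (auto intro!: continuous_intros)
  obtain z1 z2 where z12:
    "\<And>p. p \<in> J \<times> UNIV \<Longrightarrow> z1 differentiable (at p)"
    "\<And>p. p \<in> J \<times> UNIV \<Longrightarrow> z2 differentiable (at p)"
    "\<And>u v. u \<in> J \<Longrightarrow> ((\<lambda>t. z1 (t, v)) has_real_derivative cos (\<phi> u) * cos (\<alpha> * v)) (at u)"
    "\<And>u v. u \<in> J \<Longrightarrow> ((\<lambda>t. z2 (t, v)) has_real_derivative cos (\<phi> u) * sin (\<alpha> * v)) (at u)"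
    "\<And>u v. u \<in> J \<Longrightarrow> ((\<lambda>t. z1 (u, t)) has_real_derivative - (s u * cos (\<psi> u)) * sin (\<alpha> * v)) (at v)"
    "\<And>u v. u \<in> J \<Longrightarrow> ((\<lambda>t. z2 (u, t)) has_real_derivative (s u * cos (\<psi> u)) * cos (\<alpha> * v)) (at v)"
  proof (rule planar_block[OF J, of "\<lambda>u. s u * cos (\<psi> u)" \<alpha> "\<lambda>u. cos (\<phi> u)"], goal_cases)
    case (1 u)
    show ?case using 1(2) by (rule h1)
  next
    case (2 u)
    show ?case using 2(2) by (rule cont)
  next
    case (3 z1 z2)
    show thesis by (rule 3(1)[of z1 z2]) (use 3(2-) in blast)+
  qed
  obtain z3 z4 where z34:
    "\<And>p. p \<in> J \<times> UNIV \<Longrightarrow> z3 differentiable (at p)"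
    "\<And>p. p \<in> J \<times> UNIV \<Longrightarrow> z4 differentiable (at p)"
    "\<And>u v. u \<in> J \<Longrightarrow> ((\<lambda>t. z3 (t, v)) has_real_derivative sin (\<phi> u) * cos (\<beta> * v)) (at u)"
    "\<And>u v. u \<in> J \<Longrightarrow> ((\<lambda>t. z4 (t, v)) has_real_derivative sin (\<phi> u) * sin (\<beta> * v)) (at u)"
    "\<And>u v. u \<in> J \<Longrightarrow> ((\<lambda>t. z3 (u, t)) has_real_derivative - (s u * sin (\<psi> u)) * sin (\<beta> * v)) (at v)"
    "\<And>u v. u \<in> J \<Longrightarrow> ((\<lambda>t. z4 (u, t)) has_real_derivative (s u * sin (\<psi> u)) * cos (\<beta> * v)) (at v)"
  proof (rule planar_block[OF J, of "\<lambda>u. s u * sin (\<psi> u)" \<beta> "\<lambda>u. sin (\<phi> u)"], goal_cases)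
    case (1 u)
    show ?case using 1(2) by (rule h2)
  next
    case (2 u)
    show ?case using 2(2) by (rule cont)
  next
    case (3 z3 z4)
    show thesis by (rule 3(1)[of z3 z4]) (use 3(2-) in blast)+
  qed
  define z :: surf where "z p = vector [z1 p, z2 p, z3 p, z4 p]" for p
  define x :: surf where "x p = (let u = fst p; v = snd p in
    vector [cos (\<phi> u) * cos (\<alpha> * v), cos (\<phi> u) * sin (\<alpha> * v), sin (\<phi> u) * cos (\<beta> * v), sin (\<phi> u) * sin (\<beta> * v)])" for p
  define y :: surf where "y p = (let u = fst p; v = snd p in
    vector [- cos (\<psi> u) * sin (\<alpha> * v), cos (\<psi> u) * cos (\<alpha> * v), - sin (\<psi> u) * sin (\<beta> * v), sin (\<psi> u) * cos (\<beta> * v)])" for p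
  define n1 :: surf where "n1 p = (let u = fst p; v = snd p in
    vector [- sin (\<phi> u) * cos (\<alpha> * v), - sin (\<phi> u) * sin (\<alpha> * v), cos (\<phi> u) * cos (\<beta> * v), cos (\<phi> u) * sin (\<beta> * v)])" for p
  define n2 :: surf where "n2 p = (let u = fst p; v = snd p in
    vector [sin (\<psi> u) * sin (\<alpha> * v), - sin (\<psi> u) * cos (\<alpha> * v), - cos (\<psi> u) * sin (\<beta> * v), cos (\<psi> u) * cos (\<beta> * v)])" for p
  interpret adapted_frame J nu mu g b s UNIV z x y n1 n2
  proof (intro adapted_frame.intro adapted_frame_axioms.intro profile_axioms)
    show "open_interval (UNIV :: real set)" by (simp add: open_interval_def)
  next
    fix p :: "real \<times> real"
    note fr = double_rotation_frame[of "cos (\<phi> (fst p))" "sin (\<phi> (fst p))" "cos (\<psi> (fst p))" "sin (\<psi> (fst p))"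
        "cos (\<alpha> * snd p)" "sin (\<alpha> * snd p)" "cos (\<beta> * snd p)" "sin (\<beta> * snd p)", simplified sin_cos_squared_add2 simp_thms]
    show "x p \<bullet> x p = 1 \<and> y p \<bullet> y p = 1 \<and> n1 p \<bullet> n1 p = 1 \<and> n2 p \<bullet> n2 p = 1 \<and>
      x p \<bullet> y p = 0 \<and> x p \<bullet> n1 p = 0 \<and> x p \<bullet> n2 p = 0 \<and> y p \<bullet> n1 p = 0 \<and> y p \<bullet> n2 p = 0 \<and>
      n1 p \<bullet> n2 p = 0"
      unfolding x_def y_def n1_def n2_def Let_def using fr by blast
    show "det4 (x p) (y p) (n1 p) (n2 p) > 0"
      unfolding x_def y_def n1_def n2_def Let_def using fr(11) by simp
  next
    fix u v :: real assume u: "u \<in> J"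
    note defs = x_def y_def n1_def n2_def Let_def fst_conv snd_conv
    note eq = vec_eq_iff forall_4 vector_4 vector_scaleR_component vector_add_component vector_minus_component
    show "((\<lambda>t. z (t, v)) has_vector_derivative x (u, v)) (at u)"
      unfolding z_def defs
      by (rule has_vector_derivative_vector4[OF z12(3)[OF u] z12(4)[OF u] z34(3)[OF u] z34(4)[OF u] refl])
    show "((\<lambda>t. z (u, t)) has_vector_derivative s u *\<^sub>R y (u, v)) (at v)"
      unfolding z_def defs
      by (rule has_vector_derivative_vector4[OF z12(5)[OF u] z12(6)[OF u] z34(5)[OF u] z34(6)[OF u]])
        (simp add: eq)
    have du: "((\<lambda>u. cos (\<phi> u) * k) has_real_derivative - nu u * sin (\<phi> u) * k) (at u)"
      "((\<lambda>u. sin (\<phi> u) * k) has_real_derivative nu u * cos (\<phi> u) * k) (at u)"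
      "((\<lambda>u. - sin (\<phi> u) * k) has_real_derivative - nu u * cos (\<phi> u) * k) (at u)"
      "((\<lambda>u. cos (\<psi> u) * k) has_real_derivative - mu u * sin (\<psi> u) * k) (at u)"
      "((\<lambda>u. - cos (\<psi> u) * k) has_real_derivative mu u * sin (\<psi> u) * k) (at u)"
      "((\<lambda>u. sin (\<psi> u) * k) has_real_derivative mu u * cos (\<psi> u) * k) (at u)"
      "((\<lambda>u. - sin (\<psi> u) * k) has_real_derivative - mu u * cos (\<psi> u) * k) (at u)" for k
      by (auto intro!: derivative_eq_intros ang u)
    have dv: "((\<lambda>v. k * cos (c * v)) has_real_derivative - (c * k) * sin (c * v)) (at v)"
      "((\<lambda>v. k * sin (c * v)) has_real_derivative (c * k) * cos (c * v)) (at v)" for k c :: real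
      by (auto intro!: derivative_eq_intros)
    show "((\<lambda>t. x (t, v)) has_vector_derivative nu u *\<^sub>R n1 (u, v)) (at u)"
      "((\<lambda>t. y (t, v)) has_vector_derivative mu u *\<^sub>R n2 (u, v)) (at u)"
      "((\<lambda>t. n1 (t, v)) has_vector_derivative - nu u *\<^sub>R x (u, v)) (at u)"
      "((\<lambda>t. n2 (t, v)) has_vector_derivative - mu u *\<^sub>R y (u, v)) (at u)"
      unfolding defs by (rule has_vector_derivative_vector4, (rule du)+, simp add: eq)+
    show "((\<lambda>t. x (u, t)) has_vector_derivative
        s u *\<^sub>R (- g u *\<^sub>R y (u, v) + mu u *\<^sub>R n2 (u, v))) (at v)"
      "((\<lambda>t. y (u, t)) has_vector_derivative
        s u *\<^sub>R (g u *\<^sub>R x (u, v) - nu u *\<^sub>R n1 (u, v))) (at v)"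
      "((\<lambda>t. n1 (u, t)) has_vector_derivative
        s u *\<^sub>R (nu u *\<^sub>R y (u, v) + b u *\<^sub>R n2 (u, v))) (at v)"
      "((\<lambda>t. n2 (u, t)) has_vector_derivative
        s u *\<^sub>R (- mu u *\<^sub>R x (u, v) - b u *\<^sub>R n1 (u, v))) (at v)"
      unfolding defs
      by (rule has_vector_derivative_vector4, (rule dv)+, simp add: eq K[OF u] algebra_simps)+
  qed
  let ?D = "J \<times> (UNIV :: real set)"
  \<comment> \<open>The partial derivatives of these functions are polynomials in them, by the
    profile equations, the angle derivatives and the planar blocks. The coordinates
    \<open>z1\<close> to \<open>z4\<close> are generators themselves because only their partial
    derivatives are known here.\<close>
  define B where "B = {\<lambda>p. nu (fst p), \<lambda>p. mu (fst p), \<lambda>p. g (fst p), \<lambda>p. b (fst p), \<lambda>p. s (fst p),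
    \<lambda>p. cos (\<phi> (fst p)), \<lambda>p. sin (\<phi> (fst p)), \<lambda>p. cos (\<psi> (fst p)), \<lambda>p. sin (\<psi> (fst p)),
    \<lambda>p. cos (\<alpha> * snd p), \<lambda>p. sin (\<alpha> * snd p), \<lambda>p. cos (\<beta> * snd p), \<lambda>p. sin (\<beta> * snd p),
    z1, z2, z3, z4 :: real \<times> real \<Rightarrow> real}"
  have "B \<subseteq> palg ?D B" by (auto intro: palg.base)
  then have inB: "(\<lambda>p. nu (fst p)) \<in> palg ?D B" "(\<lambda>p. mu (fst p)) \<in> palg ?D B"
    "(\<lambda>p. g (fst p)) \<in> palg ?D B" "(\<lambda>p. b (fst p)) \<in> palg ?D B" "(\<lambda>p. s (fst p)) \<in> palg ?D B"
    "(\<lambda>p. cos (\<phi> (fst p))) \<in> palg ?D B" "(\<lambda>p. sin (\<phi> (fst p))) \<in> palg ?D B"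
    "(\<lambda>p. cos (\<psi> (fst p))) \<in> palg ?D B" "(\<lambda>p. sin (\<psi> (fst p))) \<in> palg ?D B"
    "(\<lambda>p. cos (\<alpha> * snd p)) \<in> palg ?D B" "(\<lambda>p. sin (\<alpha> * snd p)) \<in> palg ?D B"
    "(\<lambda>p. cos (\<beta> * snd p)) \<in> palg ?D B" "(\<lambda>p. sin (\<beta> * snd p)) \<in> palg ?D B"
    "z1 \<in> palg ?D B" "z2 \<in> palg ?D B" "z3 \<in> palg ?D B" "z4 \<in> palg ?D B"
    unfolding B_def by (simp_all only: insert_subset simp_thms)
  note palg_rules = inB palg.const palg.add palg.mult palg_diff palg_minus palg_power2
  have gen: "(\<forall>p\<in>?D. f differentiable (at p)) \<and> pu f \<in> palg ?D B \<and> pv f \<in> palg ?D B"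
    if "\<And>p. p \<in> ?D \<Longrightarrow> f differentiable (at p)"
      "\<And>u v. u \<in> J \<Longrightarrow> ((\<lambda>t. f (t, v)) has_real_derivative f1 (u, v)) (at u)" "f1 \<in> palg ?D B"
      "\<And>u v. u \<in> J \<Longrightarrow> ((\<lambda>t. f (u, t)) has_real_derivative f2 (u, v)) (at v)" "f2 \<in> palg ?D B"
    for f f1 f2 :: "real \<times> real \<Rightarrow> real"
  proof -
    have "pu f p = f1 p" "pv f p = f2 p" if "p \<in> ?D" for p
      using that \<open>\<And>u v. u \<in> J \<Longrightarrow> ((\<lambda>t. f (t, v)) has_real_derivative f1 (u, v)) (at u)\<close>
        \<open>\<And>u v. u \<in> J \<Longrightarrow> ((\<lambda>t. f (u, t)) has_real_derivative f2 (u, v)) (at v)\<close>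
      by (cases p; auto intro!: pu_eqI pv_eqI simp flip: has_real_derivative_iff_has_vector_derivative)+
    then show ?thesis
      using that palg.cong[of f1 ?D B "pu f"] palg.cong[of f2 ?D B "pv f"] by simp
  qed
  have U: "(\<forall>p\<in>?D. (\<lambda>p. f (fst p)) differentiable (at p)) \<and> pu (\<lambda>p. f (fst p)) \<in> palg ?D B
      \<and> pv (\<lambda>p. f (fst p)) \<in> palg ?D B"
    if f: "\<And>u. u \<in> J \<Longrightarrow> (f has_real_derivative f' u) (at u)" "(\<lambda>p. f' (fst p)) \<in> palg ?D B"
    for f f' :: "real \<Rightarrow> real"
  proof (rule gen[where ?f1.0 = "\<lambda>p. f' (fst p)" and ?f2.0 = "\<lambda>_. 0"])
    show "(\<lambda>p. f (fst p)) differentiable (at p)" if "p \<in> ?D" for p :: "real \<times> real"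
      by (rule differentiable_comp_fst[OF f(1)]) (use that in auto)
  qed (auto intro: f palg.const)
  have V: "(\<forall>p\<in>?D. (\<lambda>p. f (snd p)) differentiable (at p)) \<and> pu (\<lambda>p. f (snd p)) \<in> palg ?D B
      \<and> pv (\<lambda>p. f (snd p)) \<in> palg ?D B"
    if f: "\<And>v. (f has_real_derivative f' v) (at v)" "(\<lambda>p. f' (snd p)) \<in> palg ?D B"
    for f f' :: "real \<Rightarrow> real"
  proof (rule gen[where ?f2.0 = "\<lambda>p. f' (snd p)" and ?f1.0 = "\<lambda>_. 0"])
    show "(\<lambda>p. f (snd p)) differentiable (at p)" for p :: "real \<times> real"
      by (rule differentiable_comp_snd[OF f(1)])
  qed (auto intro: f palg.const)
  have trig: "((\<lambda>v. cos (c * v)) has_real_derivative - (c * sin (c * v))) (at v)"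
    "((\<lambda>v. sin (c * v)) has_real_derivative c * cos (c * v)) (at v)" for c v :: real
    by (auto intro!: derivative_eq_intros)
  have trig_ang: "((\<lambda>u. cos (\<phi> u)) has_real_derivative - (nu u * sin (\<phi> u))) (at u)"
    "((\<lambda>u. sin (\<phi> u)) has_real_derivative nu u * cos (\<phi> u)) (at u)"
    "((\<lambda>u. cos (\<psi> u)) has_real_derivative - (mu u * sin (\<psi> u))) (at u)"
    "((\<lambda>u. sin (\<psi> u)) has_real_derivative mu u * cos (\<psi> u)) (at u)" if "u \<in> J" for u
    by (auto intro!: derivative_eq_intros ang that)
  let ?Q = "\<lambda>f. (\<forall>p\<in>?D. f differentiable (at p)) \<and> pu f \<in> palg ?D B \<and> pv f \<in> palg ?D B"
  have B: "?Q f" if "f \<in> B" for f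
  proof -
    have "?Q z1"
      by (rule gen[where ?f1.0 = "\<lambda>p. cos (\<phi> (fst p)) * cos (\<alpha> * snd p)"
            and ?f2.0 = "\<lambda>p. - (s (fst p) * cos (\<psi> (fst p))) * sin (\<alpha> * snd p)"])
        (use z12 in simp, use z12 in simp, intro palg_rules, use z12 in simp, intro palg_rules)
    moreover have "?Q z2"
      by (rule gen[where ?f1.0 = "\<lambda>p. cos (\<phi> (fst p)) * sin (\<alpha> * snd p)"
            and ?f2.0 = "\<lambda>p. (s (fst p) * cos (\<psi> (fst p))) * cos (\<alpha> * snd p)"])
        (use z12 in simp, use z12 in simp, intro palg_rules, use z12 in simp, intro palg_rules)
    moreover have "?Q z3"
      by (rule gen[where ?f1.0 = "\<lambda>p. sin (\<phi> (fst p)) * cos (\<beta> * snd p)"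
            and ?f2.0 = "\<lambda>p. - (s (fst p) * sin (\<psi> (fst p))) * sin (\<beta> * snd p)"])
        (use z34 in simp, use z34 in simp, intro palg_rules, use z34 in simp, intro palg_rules)
    moreover have "?Q z4"
      by (rule gen[where ?f1.0 = "\<lambda>p. sin (\<phi> (fst p)) * sin (\<beta> * snd p)"
            and ?f2.0 = "\<lambda>p. (s (fst p) * sin (\<psi> (fst p))) * cos (\<beta> * snd p)"])
        (use z34 in simp, use z34 in simp, intro palg_rules, use z34 in simp, intro palg_rules)
    moreover have "?Q (\<lambda>p. nu (fst p))"
      "?Q (\<lambda>p. mu (fst p))"
      "?Q (\<lambda>p. g (fst p))"
      "?Q (\<lambda>p. b (fst p))"
      "?Q (\<lambda>p. s (fst p))"
      "?Q (\<lambda>p. cos (\<phi> (fst p)))"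
      "?Q (\<lambda>p. sin (\<phi> (fst p)))"
      "?Q (\<lambda>p. cos (\<psi> (fst p)))"
      "?Q (\<lambda>p. sin (\<psi> (fst p)))"
      by (rule U, rule nu_deriv mu_deriv g_deriv b_deriv s_deriv trig_ang, assumption, intro palg_rules)+
    moreover have "?Q (\<lambda>p. cos (\<alpha> * snd p))"
      "?Q (\<lambda>p. sin (\<alpha> * snd p))"
      "?Q (\<lambda>p. cos (\<beta> * snd p))"
      "?Q (\<lambda>p. sin (\<beta> * snd p))"
      by (rule V, rule trig, intro palg_rules)+
    ultimately show ?thesis
      using that[unfolded B_def] by (elim insertE emptyE) (hypsubst, assumption)+
  qed
  have smooth: "smooth2_on ?D w" if "\<forall>i. (\<lambda>p. w p $ i) \<in> palg ?D B" for w :: surf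
    using that B by (intro smooth2_on_palg[OF open_D, of B]) auto
  have "smooth2_on ?D z" "smooth2_on ?D n1" "smooth2_on ?D n2"
    by (rule smooth, simp add: forall_4 z_def n1_def n2_def Let_def vector_4, intro conjI palg_rules)+
  then show ?thesis
    using canonical_surface by blast
qed

section \<open>From the logarithmic equations to the profile system\<close>

lemma has_real_derivative_ln_abs:
  assumes "x \<noteq> (0::real)"
  shows "((\<lambda>t. ln \<bar>t\<bar>) has_real_derivative 1 / x) (at x)"
proof (cases "x > 0")
  case True
  have "((\<lambda>t. ln t) has_real_derivative 1 / x) (at x)"
    using True by (auto intro!: derivative_eq_intros)
  then show ?thesis
    by (rule has_field_derivative_transform_within_open[of _ _ _ "{0<..}"]) (use True in auto)
next
  case False
  have "((\<lambda>t. ln (- t)) has_real_derivative 1 / x) (at x)"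
    using False assms by (auto intro!: derivative_eq_intros)
  then show ?thesis
    by (rule has_field_derivative_transform_within_open[of _ _ _ "{..<0}"]) (use False assms in auto)
qed

lemma smooth1_on_deriv:
  assumes "smooth1_on J f" "u \<in> J"
  shows "(f has_real_derivative deriv f u) (at u)"
    "(deriv f has_real_derivative deriv (deriv f) u) (at u)"
proof -
  have "(deriv ^^ k) f differentiable (at u)" for k
    using assms by (auto simp: smooth1_on_def)
  from this[of 0] this[of 1] have "f differentiable (at u)" "deriv f differentiable (at u)"
    by simp_all
  then show "(f has_real_derivative deriv f u) (at u)"
    "(deriv f has_real_derivative deriv (deriv f) u) (at u)"
    by (simp_all add: DERIV_deriv_iff_real_differentiable)
qed

text \<open>Near \<open>u\<close> the function \<open>deriv f\<close> coincides with the
  differentiable \<open>f'\<close>. This ensures that an iterated \<open>deriv\<close> is a genuine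
  second derivative and not an arbitrary value.\<close>

lemma deriv_has_derivative_of_eq_on_open:
  fixes f f' :: "real \<Rightarrow> real"
  assumes "open J" "u \<in> J" "\<And>t. t \<in> J \<Longrightarrow> (f has_real_derivative f' t) (at t)"
    and "f' differentiable (at u)"
  shows "(deriv f has_real_derivative deriv (deriv f) u) (at u)"
proof -
  have "f' t = deriv f t" if "t \<in> J" for t
    using assms(3)[OF that] by (simp add: DERIV_imp_deriv)
  moreover obtain d where "(f' has_real_derivative d) (at u)"
    using assms(4) real_differentiable_def by blast
  ultimately have "(deriv f has_real_derivative d) (at u)"
    using has_field_derivative_transform_within_open assms(1,2) by blast
  then show ?thesis
    by (simp add: DERIV_imp_deriv)
qed

theorem theorem7p4:
  fixes J :: "real set" and nu mu :: "real \<Rightarrow> real"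
  defines "L1 \<equiv> (\<lambda>u. ln \<bar>(mu u)\<^sup>2 - (nu u)\<^sup>2\<bar>)"
      and "L2 \<equiv> (\<lambda>u. ln \<bar>(mu u + nu u) / (mu u - nu u)\<bar>)"
  assumes J: "open_interval J"
      and smooth_nu: "smooth1_on J nu" and smooth_mu: "smooth1_on J mu"
      and mu_pos: "\<forall>u\<in>J. mu u > 0"
      and nu_nz: "\<forall>u\<in>J. nu u \<noteq> 0"
      and sq_ne: "\<forall>u\<in>J. (mu u)\<^sup>2 \<noteq> (nu u)\<^sup>2"
      and d1: "\<forall>u\<in>J. deriv (\<lambda>t. \<bar>(mu t)\<^sup>2 - (nu t)\<^sup>2\<bar>) u \<noteq> 0"
      and d2: "\<forall>u\<in>J. deriv (\<lambda>t. \<bar>(mu t + nu t) / (mu t - nu t)\<bar>) u \<noteq> 0"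
      and eq1: "\<forall>u\<in>J. (1/4) * deriv (deriv L1) u - (1/16) * (deriv L1 u)\<^sup>2
                        + (nu u)\<^sup>2 + (mu u)\<^sup>2 = 0"
      and eq2: "\<forall>u\<in>J. (1/2) * deriv (deriv L2) u - (1/8) * deriv L1 u * deriv L2 u
                        + 2 * nu u * mu u = 0"
  shows "(\<exists>J' (z :: real \<times> real \<Rightarrow> real^4).
            open_interval J' \<and> canonical_surface z (J \<times> J') nu mu)
       \<and> (\<forall>J1 J2 (z1 :: real \<times> real \<Rightarrow> real^4) (z2 :: real \<times> real \<Rightarrow> real^4).
            open_interval J1 \<longrightarrow> open_interval J2 \<longrightarrow>
            canonical_surface z1 (J \<times> J1) nu mu \<longrightarrow> canonical_surface z2 (J \<times> J2) nu mu \<longrightarrow>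
            (\<exists>(A :: real^4^4) b. orthogonal_matrix A \<and> det A = 1 \<and>
                (\<forall>p \<in> J \<times> (J1 \<inter> J2). z2 p = A *v z1 p + b)))"
proof -
  have open_J: "open J" using J by (simp add: open_interval_def)
  note nu' = smooth1_on_deriv[OF smooth_nu] and mu' = smooth1_on_deriv[OF smooth_mu]
  have pm: "mu u - nu u \<noteq> 0" "mu u + nu u \<noteq> 0" "(mu u)\<^sup>2 - (nu u)\<^sup>2 \<noteq> 0" if "u \<in> J" for u
    using sq_ne that by (auto simp: power2_eq_square eq_neg_iff_add_eq_0[symmetric])
  \<comment> \<open>These are the logarithmic derivatives over the common denominator \<mu>^2 -
    \<nu>^2.\<close>
  let ?L1' = "\<lambda>u. (2 * mu u * deriv mu u - 2 * nu u * deriv nu u) / ((mu u)\<^sup>2 - (nu u)\<^sup>2)"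
  let ?L2' = "\<lambda>u. (2 * mu u * deriv nu u - 2 * nu u * deriv mu u) / ((mu u)\<^sup>2 - (nu u)\<^sup>2)"
  have L1': "(L1 has_real_derivative ?L1' u) (at u)" if u: "u \<in> J" for u
    unfolding L1_def
    by (rule DERIV_chain2[OF has_real_derivative_ln_abs, THEN DERIV_cong])
      (use pm[OF u] in \<open>auto intro!: derivative_eq_intros mu'(1)[OF u] nu'(1)[OF u]\<close>)
  have L2': "(L2 has_real_derivative ?L2' u) (at u)" if u: "u \<in> J" for u
  proof -
    have d: "((\<lambda>u. (mu u + nu u) / (mu u - nu u)) has_real_derivative
        (2 * mu u * deriv nu u - 2 * nu u * deriv mu u) / (mu u - nu u)\<^sup>2) (at u)"
      using pm[OF u]
      by (auto intro!: derivative_eq_intros mu'(1)[OF u] nu'(1)[OF u] simp: power2_eq_square algebra_simps)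
    have "(mu u + nu u) / (mu u - nu u) \<noteq> 0"
      using pm[OF u] by simp
    from DERIV_chain2[OF has_real_derivative_ln_abs[OF this] d]
    show ?thesis
      unfolding L2_def
      by (rule DERIV_cong) (use pm[OF u] in \<open>simp add: divide_simps\<close>, simp add: algebra_simps power2_eq_square)
  qed
  have diff: "?L1' differentiable (at u)" "?L2' differentiable (at u)" if u: "u \<in> J" for u
  proof -
    have "mu differentiable (at u)" "nu differentiable (at u)"
      "deriv mu differentiable (at u)" "deriv nu differentiable (at u)"
      using mu'[OF u] nu'[OF u] real_differentiable_def by blast+
    then show "?L1' differentiable (at u)" "?L2' differentiable (at u)"
      using pm[OF u] by (auto intro!: derivative_intros)
  qed
  have L1'': "(deriv L1 has_real_derivative deriv (deriv L1) u) (at u)" if "u \<in> J" for u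
    by (rule deriv_has_derivative_of_eq_on_open[OF open_J that L1' diff(1)[OF that]])
  have L2'': "(deriv L2 has_real_derivative deriv (deriv L2) u) (at u)" if "u \<in> J" for u
    by (rule deriv_has_derivative_of_eq_on_open[OF open_J that L2' diff(2)[OF that]])
  note dL = DERIV_imp_deriv[OF L1'] DERIV_imp_deriv[OF L2']
  \<comment> \<open>These will be \<open>\<gamma>\<^sub>2\<close>, \<open>\<beta>\<^sub>2\<close>
    and \<open>\<surd>G\<close>; the factor 1/4 in the exponent makes the square of \<open>s\<close>
    equal to the prescribed G.\<close>
  define g b s where "g u = deriv L1 u / 4" and "b u = deriv L2 u / 2" and "s u = exp (- L1 u / 4)" for u
  interpret profile J nu mu g b s
  proof
    show "open_interval J" by fact
  next
    fix u assume u: "u \<in> J"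
    \<comment> \<open>The formulas for \<open>g\<close> and \<open>b\<close> are linear in the
      derivatives of \<open>nu\<close> and \<open>mu\<close>, and are solved using \<mu>^2 \<noteq>
      \<nu>^2.\<close>
    have "2 * g u * nu u + b u * mu u = deriv nu u" "2 * g u * mu u + b u * nu u = deriv mu u"
      using pm(3)[OF u] by (simp_all add: g_def b_def dL[OF u] divide_simps)
        (simp_all add: algebra_simps power2_eq_square)
    then show "(nu has_real_derivative 2 * g u * nu u + b u * mu u) (at u)"
      "(mu has_real_derivative 2 * g u * mu u + b u * nu u) (at u)"
      using mu'(1)[OF u] nu'(1)[OF u] by simp_all
    have "deriv (deriv L1) u / 4 = (g u)\<^sup>2 - (mu u)\<^sup>2 - (nu u)\<^sup>2"
      using bspec[OF eq1 u] by (simp add: g_def power2_eq_square algebra_simps)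
    then show "(g has_real_derivative (g u)\<^sup>2 - (mu u)\<^sup>2 - (nu u)\<^sup>2) (at u)"
      using DERIV_cdivide[OF L1''[OF u], of 4] by (simp only: g_def[abs_def])
    have "deriv (deriv L2) u / 2 = g u * b u - 2 * mu u * nu u"
      using bspec[OF eq2 u] by (simp add: g_def b_def algebra_simps)
    then show "(b has_real_derivative g u * b u - 2 * mu u * nu u) (at u)"
      using DERIV_cdivide[OF L2''[OF u], of 2] by (simp only: b_def[abs_def])
    have "(L1 has_real_derivative deriv L1 u) (at u)"
      using L1'[OF u] by (simp only: dL[OF u])
    then show "(s has_real_derivative - g u * s u) (at u)"
      unfolding s_def[abs_def] by (auto intro!: derivative_eq_intros simp: g_def)
    show "s u > 0" by (simp add: s_def)
    show "s u * s u = \<bar>(mu u)\<^sup>2 - (nu u)\<^sup>2\<bar> powr (-1/2)"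
      using pm(3)[OF u] by (simp add: s_def L1_def powr_def flip: exp_add)
  qed (use mu_pos nu_nz sq_ne in auto)
  have "\<exists>(A :: real^4^4) c. orthogonal_matrix A \<and> det A = 1 \<and> (\<forall>p \<in> J \<times> (J1 \<inter> J2). z2 p = A *v z1 p + c)"
    if surf: "open_interval J1" "open_interval J2" "canonical_surface z1 (J \<times> J1) nu mu"
      "canonical_surface z2 (J \<times> J2) nu mu" for J1 J2 and z1 z2 :: surf
  proof (cases "J1 \<inter> J2 = {}")
    case True
    then show ?thesis
      \<comment> \<open>Disjoint strips have no common point, so the identity motion serves.\<close>
      by (intro exI[of _ "mat 1"] exI[of _ 0]) (auto simp: orthogonal_matrix_id)
  next
    case False
    obtain m1 n1 where F1:
      "adapted_frame J nu mu g b s J1 z1 (pu z1) (\<lambda>q. (1 / s (fst q)) *\<^sub>R pv z1 q) m1 n1"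
      using adapted_frame_of_canonical_surface[OF surf(1,3)] by blast
    obtain m2 n2 where F2:
      "adapted_frame J nu mu g b s J2 z2 (pu z2) (\<lambda>q. (1 / s (fst q)) *\<^sub>R pv z2 q) m2 n2"
      using adapted_frame_of_canonical_surface[OF surf(2,4)] by blast
    show ?thesis
      by (rule adapted_frames_congruent[OF F1 F2 False])
  qed
  moreover have "open_interval (UNIV :: real set)" by (simp add: open_interval_def)
  ultimately show ?thesis
    using exists_canonical_surface by blast
qed

end
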